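(* For every $c\in(0,1)$, \[ \Pr\bigl[L^{main}\le c\ln n\,\big|\,\mathbf{COND}\bigr]=e^{-(K(c)+o(1))\ln n}\qquad(n\to\infty), \] where $K(c)=\frac{(1-c)^2}{8c}$.
   Context: For $n$ large let $A=\lfloor\ln^{10}n\rfloor$. Let $\xi_1,\dots,\xi_{2n-2}$ be i.i.d. uniform on $\{-1,+1\}$, $S_t=\sum_{i=1}^t\xi_i$ ($S_0=0$). $\mathbf{COND}$ is the event $\{S_{2A-2}=0\}\cap\{S_{2n-2}=0\}$, and $L^{main}=\sum_{i=2A-1}^{2n-2}S_i^2/i^2$. *)

theory Defs
  imports "HOL-Analysis.Analysis"
begin

text \<open>A step sequence \<xi>_1,...,\<xi>_{2n-2} is encoded as an int list of length 2n-2
  with entries in {-1,1}; uniform measure = counting measure on this finite set.\<close>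

definition paths :: "nat \<Rightarrow> int list set" where
  "paths n = {xs. length xs = 2*n - 2 \<and> set xs \<subseteq> {-1, 1}}"

definition Spart :: "int list \<Rightarrow> nat \<Rightarrow> int" where
  "Spart xs t = sum_list (take t xs)"

definition Apar :: "nat \<Rightarrow> nat" where
  "Apar n = nat \<lfloor>(ln (real n)) ^ 10\<rfloor>"

definition COND :: "nat \<Rightarrow> int list \<Rightarrow> bool" where
  "COND n xs \<longleftrightarrow> Spart xs (2 * Apar n - 2) = 0 \<and> Spart xs (2*n - 2) = 0"

definition Lmain :: "nat \<Rightarrow> int list \<Rightarrow> real" where
  "Lmain n xs = (\<Sum>i = 2 * Apar n - 1 .. 2*n - 2. real_of_int (Spart xs i) ^ 2 / real i ^ 2)"

definition condprob :: "real \<Rightarrow> nat \<Rightarrow> real" where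
  "condprob c n =
     real (card {xs \<in> paths n. COND n xs \<and> Lmain n xs \<le> c * ln (real n)})
     / real (card {xs \<in> paths n. COND n xs})"

definition Kfun :: "real \<Rightarrow> real" where
  "Kfun c = (1 - c)^2 / (8 * c)"

end

theory Submission
  imports Defs "HOL-Real_Asymp.Real_Asymp"
begin

text \<open>
  After splitting off the first \<open>2 A - 2\<close> steps, the conditional law is that of a simple random walk
  bridge, and the theorem is a large deviation bound for the energy \<open>\<Sum> S\<^sub>i\<^sup>2 / i\<^sup>2\<close>, obtained from its
  Laplace transform: with \<open>\<lambda> = a (a + 1) / 2\<close> the mean of \<open>exp (- \<lambda> L)\<close> over bridges is \<open>n\<close> to the
  power \<open>- a / 2 + o(1)\<close>, for every \<open>a > 0\<close>. Optimising \<open>\<lambda> c - a / 2\<close> gives \<open>- K(c)\<close> at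
  \<open>a = (1 - c) / (2 c)\<close>, and the matching lower bound is the usual tilting argument.

  The Laplace transform is controlled by Gaussian functions \<open>exp (- a x\<^sup>2 / (2 i))\<close>: since
  \<open>cosh y\<close> is about \<open>exp (y\<^sup>2 / 2)\<close>, they are super- or subharmonic for the walk killed
  at rate \<open>\<lambda> x\<^sup>2 / i\<^sup>2\<close>, according to whether \<open>\<lambda>\<close> is slightly above or below \<open>a (a + 1) / 2\<close>.
  The condition \<open>S = 0\<close> at the end costs the factor \<open>n\<close> to the power \<open>- 1 / 2\<close>, the same
  as in the denominator. In the upper bound this factor comes from the free walk on the last half of
  the steps; in the lower bound from the fact that the killed walk has a symmetric
  unimodal endpoint distribution, so that \<open>0\<close> is its most likely endpoint.
\<close>

subsection \<open>Walks weighted by their energy\<close>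

definition walks :: "nat \<Rightarrow> int list set" where
  "walks k = {zs. length zs = k \<and> set zs \<subseteq> {-1, 1}}"

text \<open>The walk starts from 0 at time \<open>m\<close>, so its \<open>j\<close>-th position
  gets the denominator of time \<open>m + j\<close>, as in \<open>Lmain\<close>.\<close>

definition scaled_energy :: "nat \<Rightarrow> int list \<Rightarrow> real" where
  "scaled_energy m zs = (\<Sum>j = 1..length zs. real_of_int (Spart zs j) ^ 2 / real (m + j) ^ 2)"

text \<open>The Feynman-Kac kernel of the killed walk, not divided by \<open>2 ^ k\<close>, so that
  \<open>l = 0\<close> gives binomial coefficients.\<close>

definition tilted_count :: "real \<Rightarrow> nat \<Rightarrow> nat \<Rightarrow> int \<Rightarrow> real" where
  "tilted_count l m k x = (\<Sum>zs \<in> walks k. exp (- l * scaled_energy m zs) * of_bool (sum_list zs = x))"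

lemma walks_0 [simp]: "walks 0 = {[]}"
  by (auto simp: walks_def)

lemma finite_walks [simp]: "finite (walks k)"
proof -
  have "walks k \<subseteq> {zs. set zs \<subseteq> {-1, 1} \<and> length zs = k}"
    by (auto simp: walks_def)
  then show ?thesis
    using finite_lists_length_eq[of "{-1, 1 :: int}" k] by (simp add: finite_subset)
qed

lemma walks_Suc: "walks (Suc k) = (\<lambda>zs. zs @ [1]) ` walks k \<union> (\<lambda>zs. zs @ [-1]) ` walks k"
proof (intro equalityI subsetI)
  fix xs assume xs: "xs \<in> walks (Suc k)"
  then obtain ys y where "xs = ys @ [y]"
    by (metis (mono_tags, lifting) list.size(3) mem_Collect_eq nat.distinct(1) rev_exhaust walks_def)
  moreover from this xs have "ys \<in> walks k" "y = 1 \<or> y = -1"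
    by (auto simp: walks_def)
  ultimately show "xs \<in> (\<lambda>zs. zs @ [1]) ` walks k \<union> (\<lambda>zs. zs @ [-1]) ` walks k"
    by blast
qed (auto simp: walks_def)

lemma sum_walks_Suc:
  "(\<Sum>zs \<in> walks (Suc k). f zs) = (\<Sum>zs \<in> walks k. f (zs @ [1]) + f (zs @ [-1]) :: real)"
proof -
  have "(\<Sum>zs \<in> walks (Suc k). f zs) =
      (\<Sum>zs \<in> (\<lambda>zs. zs @ [1]) ` walks k. f zs) + (\<Sum>zs \<in> (\<lambda>zs. zs @ [-1]) ` walks k. f zs)"
    unfolding walks_Suc by (intro sum.union_disjoint) auto
  also have "\<dots> = (\<Sum>zs \<in> walks k. f (zs @ [1])) + (\<Sum>zs \<in> walks k. f (zs @ [-1]))"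
    by (simp add: sum.reindex inj_on_def)
  finally show ?thesis by (simp add: sum.distrib)
qed

lemma length_walks: "zs \<in> walks k \<Longrightarrow> length zs = k"
  by (simp add: walks_def)

lemma scaled_energy_Nil [simp]: "scaled_energy m [] = 0"
  by (simp add: scaled_energy_def)

lemma scaled_energy_nonneg: "scaled_energy m zs \<ge> 0"
  by (auto simp: scaled_energy_def intro!: sum_nonneg)

lemma scaled_energy_snoc:
  "scaled_energy m (zs @ [s]) = scaled_energy m zs + real_of_int (sum_list zs + s) ^ 2 / real (m + length zs + 1) ^ 2"
proof -
  have "(\<Sum>j = 1..length zs. real_of_int (Spart (zs @ [s]) j) ^ 2 / real (m + j) ^ 2) = scaled_energy m zs"
    unfolding scaled_energy_def by (intro sum.cong) (auto simp: Spart_def)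
  then show ?thesis
    by (simp add: scaled_energy_def Spart_def)
qed

lemma scaled_energy_snoc_walk:
  "zs \<in> walks k \<Longrightarrow>
    scaled_energy m (zs @ [s]) = scaled_energy m zs + real_of_int (sum_list zs + s) ^ 2 / real (m + Suc k) ^ 2"
  by (simp add: scaled_energy_snoc length_walks)

section \<open>Recursion, symmetry and unimodality of the endpoint weights\<close>

lemma tilted_count_0: "tilted_count l m 0 x = of_bool (x = 0)"
  by (auto simp: tilted_count_def)

text \<open>The energy of the last step depends only on the endpoint \<open>x\<close>, so its weight
  factors out of the sum over the two predecessors.\<close>

lemma tilted_count_Suc:
  "tilted_count l m (Suc k) x =
     exp (- l * (real_of_int x ^ 2 / real (m + Suc k) ^ 2)) * (tilted_count l m k (x - 1) + tilted_count l m k (x + 1))"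
proof -
  have "exp (- l * scaled_energy m (zs @ [1])) * of_bool (sum_list (zs @ [1]) = x) +
        exp (- l * scaled_energy m (zs @ [-1])) * of_bool (sum_list (zs @ [-1]) = x) =
        exp (- l * (real_of_int x ^ 2 / real (m + Suc k) ^ 2)) *
        (exp (- l * scaled_energy m zs) * of_bool (sum_list zs = x - 1) +
         exp (- l * scaled_energy m zs) * of_bool (sum_list zs = x + 1))" if "zs \<in> walks k" for zs
  proof -
    consider "sum_list zs = x - 1" | "sum_list zs = x + 1" | "sum_list zs \<noteq> x - 1" "sum_list zs \<noteq> x + 1"
      by blast
    then show ?thesis
      by cases (auto simp: scaled_energy_snoc_walk[OF that] distrib_left simp flip: exp_add)
  qed
  then have "tilted_count l m (Suc k) x = (\<Sum>zs\<in>walks k.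
        exp (- l * (real_of_int x ^ 2 / real (m + Suc k) ^ 2)) *
        (exp (- l * scaled_energy m zs) * of_bool (sum_list zs = x - 1) +
         exp (- l * scaled_energy m zs) * of_bool (sum_list zs = x + 1)))"
    unfolding tilted_count_def sum_walks_Suc by (intro sum.cong refl)
  then show ?thesis
    unfolding sum_distrib_left[symmetric] sum.distrib tilted_count_def .
qed

lemma tilted_count_nonneg: "tilted_count l m k x \<ge> 0"
  by (auto simp: tilted_count_def intro!: sum_nonneg)

lemma tilted_count_minus: "tilted_count l m k (- x) = tilted_count l m k x"
proof (induction k arbitrary: x)
  case 0
  then show ?case by (simp add: tilted_count_0)
next
  case (Suc k)
  have "tilted_count l m k (- x - 1) = tilted_count l m k (x + 1)" "tilted_count l m k (- x + 1) = tilted_count l m k (x - 1)"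
    using Suc[of "x + 1"] Suc[of "x - 1"] by (simp_all add: minus_diff_commute)
  then show ?case by (simp add: tilted_count_Suc add.commute)
qed

text \<open>Unimodality survives each step: summing over neighbours preserves it, and the energy
  weight itself decreases with the distance from 0. Positions are compared at distance 2 because of
  parity.\<close>

lemma tilted_count_decreasing:
  assumes "l \<ge> 0" "x \<ge> -1"
  shows "tilted_count l m k (x + 2) \<le> tilted_count l m k x"
  using assms(2)
proof (induction k arbitrary: x)
  case 0
  then show ?case by (auto simp: tilted_count_0)
next
  case (Suc k)
  have "(real_of_int x)^2 \<le> (real_of_int (x + 2))^2"
    using Suc.prems by (intro abs_le_square_iff[THEN iffD1]) auto
  then have w: "exp (- l * (real_of_int (x + 2) ^ 2 / real (m + Suc k) ^ 2))
        \<le> exp (- l * (real_of_int x ^ 2 / real (m + Suc k) ^ 2))"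
    using assms(1) by (simp add: divide_right_mono mult_left_mono)
  \<comment> \<open>With the common neighbour \<open>x + 1\<close> cancelled, only this comparison
    remains. Near the origin, symmetry replaces one or both descents by 2.\<close>
  have "tilted_count l m k (x + 3) \<le> tilted_count l m k (x - 1)"
  proof -
    consider "x = -1" | "x = 0" | "x \<ge> 1" using Suc.prems by linarith
    then show ?thesis
    proof cases
      case 1
      then show ?thesis using tilted_count_minus[of l m k 2] by simp
    next
      case 2
      then show ?thesis using Suc.IH[of 1] tilted_count_minus[of l m k 1] by simp
    next
      case 3
      then show ?thesis using Suc.IH[of "x + 1"] Suc.IH[of "x - 1"] by (simp add: algebra_simps)
    qed
  qed
  then have "tilted_count l m k (x + 2 - 1) + tilted_count l m k (x + 2 + 1) \<le> tilted_count l m k (x - 1) + tilted_count l m k (x + 1)"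
    by (simp add: algebra_simps)
  with w show ?case
    unfolding tilted_count_Suc by (intro mult_mono) (auto intro: add_nonneg_nonneg tilted_count_nonneg)
qed

lemma tilted_count_odd:
  assumes "odd (x + int k)"
  shows "tilted_count l m k x = 0"
  using assms
proof (induction k arbitrary: x)
  case 0
  then show ?case by (auto simp: tilted_count_0)
next
  case (Suc k)
  then show ?case using Suc.IH[of "x - 1"] Suc.IH[of "x + 1"] by (simp add: tilted_count_Suc)
qed

text \<open>After reflection, even positions descend to 0 in steps of 2; odd ones have weight 0
  since \<open>k\<close> is even. Applied to the free walk in the upper bound and to the killed walk
  in the lower bound.\<close>

lemma tilted_count_le_centre:
  assumes "l \<ge> 0" "even k"
  shows "tilted_count l m k x \<le> tilted_count l m k 0"
proof -
  have *: "tilted_count l m k (2 * int j) \<le> tilted_count l m k 0" for j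
  proof (induction j)
    case (Suc j)
    have "tilted_count l m k (2 * int j + 2) \<le> tilted_count l m k (2 * int j)"
      by (rule tilted_count_decreasing) (use assms in auto)
    with Suc show ?case by (simp add: algebra_simps)
  qed auto
  show ?thesis
  proof (cases "even x")
    case True
    then obtain y where y: "x = 2 * y" by blast
    have "tilted_count l m k x = tilted_count l m k (2 * int (nat \<bar>y\<bar>))"
      using y tilted_count_minus[of l m k x] by (auto simp: abs_if)
    with *[of "nat \<bar>y\<bar>"] show ?thesis by simp
  next
    case False
    then show ?thesis using assms tilted_count_odd[of x k l m] tilted_count_nonneg[of l m k 0] by simp
  qed
qed

lemma tilted_count_outside: "\<bar>x\<bar> > int k \<Longrightarrow> tilted_count l m k x = 0"
proof (induction k arbitrary: x)
  case 0
  then show ?case by (auto simp: tilted_count_0)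
next
  case (Suc k)
  then show ?case using Suc.IH[of "x - 1"] Suc.IH[of "x + 1"] by (simp add: tilted_count_Suc)
qed

section \<open>Free walks and binomial coefficients\<close>

lemma tilted_count_binomial: "tilted_count 0 m k (2 * int i - int k) = real (k choose i)"
proof (induction k arbitrary: i)
  case 0
  then show ?case by (auto simp: tilted_count_0)
next
  case (Suc k)
  have a: "tilted_count 0 m k (2 * int i - int (Suc k) + 1) = real (k choose i)"
    using Suc[of i] by simp
  show ?case
  proof (cases i)
    case 0
    have "tilted_count 0 m k (2 * int i - int (Suc k) - 1) = 0"
      using 0 by (intro tilted_count_outside) auto
    then show ?thesis using a 0 by (simp add: tilted_count_Suc)
  next
    case (Suc i')
    have "tilted_count 0 m k (2 * int i - int (Suc k) - 1) = real (k choose i')"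
      using Suc.IH[of i'] Suc by (simp add: algebra_simps)
    then show ?thesis using a Suc by (simp add: tilted_count_Suc)
  qed
qed

lemma tilted_count_central: "tilted_count 0 m (2 * q) 0 = real ((2 * q) choose q)"
  using tilted_count_binomial[of m "2 * q" q] by simp

lemma card_bridges: "real (card {zs \<in> walks (2 * q). sum_list zs = 0}) = real ((2 * q) choose q)"
proof -
  have "tilted_count 0 0 (2 * q) 0 = real (card {zs \<in> walks (2 * q). sum_list zs = 0})"
    by (simp add: tilted_count_def of_bool_def sum.If_cases Int_def)
  then show ?thesis by (simp add: tilted_count_central)
qed

text \<open>Discarding the energy of the last \<open>k'\<close> steps only increases weights; the
  rest is the Markov property.\<close>

lemma tilted_count_add_le:
  assumes "l \<ge> 0"
  shows "tilted_count l m (k + k') x \<le>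
    (\<Sum>ys \<in> walks k. exp (- l * scaled_energy m ys) * tilted_count 0 0 k' (x - sum_list ys))"
proof (induction k' arbitrary: x)
  case 0
  have "tilted_count l m k x = (\<Sum>ys \<in> walks k. exp (- l * scaled_energy m ys) * tilted_count 0 0 0 (x - sum_list ys))"
    by (simp add: tilted_count_def[of l m k x] tilted_count_0 eq_commute[of _ x])
  then show ?case by simp
next
  case (Suc k')
  have "exp (- l * (real_of_int x ^ 2 / real (m + Suc (k + k')) ^ 2)) \<le> 1"
    using assms by simp
  then have "tilted_count l m (k + Suc k') x \<le> 1 * (tilted_count l m (k + k') (x - 1) + tilted_count l m (k + k') (x + 1))"
    unfolding add_Suc_right tilted_count_Suc
    by (rule mult_right_mono) (simp add: tilted_count_nonneg)
  also have "\<dots> \<le> (\<Sum>ys \<in> walks k. exp (- l * scaled_energy m ys) * tilted_count 0 0 k' (x - 1 - sum_list ys))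
     + (\<Sum>ys \<in> walks k. exp (- l * scaled_energy m ys) * tilted_count 0 0 k' (x + 1 - sum_list ys))"
    using Suc[of "x - 1"] Suc[of "x + 1"] by simp
  also have "\<dots> = (\<Sum>ys \<in> walks k. exp (- l * scaled_energy m ys) * tilted_count 0 0 (Suc k') (x - sum_list ys))"
  proof -
    have "exp (- l * scaled_energy m ys) * tilted_count 0 0 (Suc k') (x - sum_list ys) =
        exp (- l * scaled_energy m ys) * tilted_count 0 0 k' (x - 1 - sum_list ys) +
        exp (- l * scaled_energy m ys) * tilted_count 0 0 k' (x + 1 - sum_list ys)" for ys
    proof -
      have "x - sum_list ys - 1 = x - 1 - sum_list ys" "x - sum_list ys + 1 = x + 1 - sum_list ys"
        by simp_all
      then show ?thesis by (simp only: tilted_count_Suc distrib_left) simp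
    qed
    then show ?thesis by (simp only: sum.distrib)
  qed
  finally show ?case .
qed

subsection \<open>Reduction to bridges\<close>

text \<open>A conditioned path is at 0 at time \<open>2 * Apar n - 2\<close>, so it splits into two
  bridges. The energy sum starts one step later and sees only the second; the number of first
  bridges cancels in the quotient.\<close>

lemma condprob_bridges:
  assumes "1 \<le> Apar n" "Apar n \<le> n"
  defines "m \<equiv> 2 * Apar n - 2" and "B \<equiv> {zs \<in> walks (2 * (n - Apar n)). sum_list zs = 0}"
  shows "condprob c n = real (card {zs \<in> B. scaled_energy m zs \<le> c * ln (real n)}) / real (card B)"
proof -
  define I where "I = {ys \<in> walks m. sum_list ys = 0}"
  have len: "m + 2 * (n - Apar n) = 2 * n - 2" using assms by (simp add: m_def)
  have L: "Lmain n (ys @ zs) = scaled_energy m zs" if "ys \<in> I" "zs \<in> B" for ys zs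
  proof -
    have lz: "length zs = 2 * (n - Apar n)" "length ys = m" "sum_list ys = 0"
      using that by (auto simp: B_def I_def walks_def)
    have "2 * Apar n - 1 = 1 + m" "2 * n - 2 = length zs + m" using assms len lz by (auto simp: m_def)
    then have "Lmain n (ys @ zs) = (\<Sum>i = 1 + m..length zs + m. real_of_int (Spart (ys @ zs) i) ^ 2 / real i ^ 2)"
      by (simp add: Lmain_def)
    also have "\<dots> = (\<Sum>j = 1..length zs. real_of_int (Spart (ys @ zs) (j + m)) ^ 2 / real (j + m) ^ 2)"
      by (rule sum.shift_bounds_cl_nat_ivl)
    also have "\<dots> = scaled_energy m zs"
      unfolding scaled_energy_def using lz by (intro sum.cong) (auto simp: Spart_def add.commute)
    finally show ?thesis .
  qed
  \<comment> \<open>A general \<open>P\<close> lets one bijection count both the event and, with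
    \<open>P\<close> constantly true, the conditioning set.\<close>
  have "bij_betw (\<lambda>(ys, zs). ys @ zs) (I \<times> {zs \<in> B. P (scaled_energy m zs)}) {xs \<in> paths n. COND n xs \<and> P (Lmain n xs)}" for P
  proof (rule bij_betwI[where g = "\<lambda>xs. (take m xs, drop m xs)"])
    show "(\<lambda>(ys, zs). ys @ zs) \<in> I \<times> {zs \<in> B. P (scaled_energy m zs)} \<rightarrow> {xs \<in> paths n. COND n xs \<and> P (Lmain n xs)}"
    proof (clarsimp, intro conjI)
      fix ys zs assume *: "ys \<in> I" "zs \<in> B" "P (scaled_energy m zs)"
      show "ys @ zs \<in> paths n" using * len by (auto simp: I_def B_def walks_def paths_def)
      show "COND n (ys @ zs)"
        using * len by (auto simp: I_def B_def walks_def COND_def Spart_def m_def)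
      show "P (Lmain n (ys @ zs))" using L * by simp
    qed
    show "(\<lambda>xs. (take m xs, drop m xs)) \<in> {xs \<in> paths n. COND n xs \<and> P (Lmain n xs)} \<rightarrow> I \<times> {zs \<in> B. P (scaled_energy m zs)}"
    proof (clarify, intro SigmaI CollectI conjI)
      fix xs assume *: "xs \<in> paths n" "COND n xs" "P (Lmain n xs)"
      then have l: "length xs = m + 2 * (n - Apar n)" using len by (simp add: paths_def)
      show I: "take m xs \<in> I"
        using * l by (auto simp: I_def walks_def paths_def COND_def Spart_def m_def dest: in_set_takeD)
      have "sum_list (take m xs @ drop m xs) = 0"
        using * unfolding append_take_drop_id by (auto simp: COND_def Spart_def paths_def)
      then have "sum_list (drop m xs) = 0" using I unfolding sum_list_append I_def by simp
      then show B: "drop m xs \<in> B"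
        using * l by (auto simp: B_def walks_def paths_def dest: in_set_dropD)
      show "P (scaled_energy m (drop m xs))" using L[OF I B] * by simp
    qed
    show "\<And>x. x \<in> I \<times> {zs \<in> B. P (scaled_energy m zs)} \<Longrightarrow> (\<lambda>xs. (take m xs, drop m xs)) (case x of (ys, zs) \<Rightarrow> ys @ zs) = x"
      by (auto simp: I_def walks_def)
  qed auto
  from this[THEN bij_betw_same_card]
  have card: "card {xs \<in> paths n. COND n xs \<and> P (Lmain n xs)} = card I * card {zs \<in> B. P (scaled_energy m zs)}" for P
    by (simp add: card_cartesian_product)
  have "real (card I) = real ((2 * (Apar n - 1)) choose (Apar n - 1))"
    using card_bridges[of "Apar n - 1"] by (simp add: I_def m_def diff_mult_distrib2)
  then have "real (card I) > 0" by simp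
  then show ?thesis
    using card[of "\<lambda>x. x \<le> c * ln (real n)"] card[of "\<lambda>_. True"] by (simp add: condprob_def)
qed

subsection \<open>Gaussian super- and subharmonic functions\<close>

lemma sinh_ge_self: "sinh x \<ge> (x::real)" if "x \<ge> 0"
proof -
  have "sinh 0 - 0 \<le> sinh x - x"
    by (rule DERIV_nonneg_imp_nondecreasing[OF that])
       (auto intro!: exI derivative_eq_intros simp: cosh_real_ge_1)
  then show ?thesis by simp
qed

lemma cosh_ge_quadratic: "cosh x \<ge> 1 + x\<^sup>2 / 2" for x :: real
proof -
  have *: "cosh x \<ge> 1 + x\<^sup>2 / 2" if "x \<ge> 0" for x :: real
  proof -
    have "cosh 0 - 0\<^sup>2 / 2 \<le> cosh x - x\<^sup>2 / 2"
    proof (rule DERIV_nonneg_imp_nondecreasing[OF that])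
      fix y :: real assume "0 \<le> y"
      show "\<exists>d. ((\<lambda>x. cosh x - x\<^sup>2 / 2) has_real_derivative d) (at y) \<and> 0 \<le> d"
        using sinh_ge_self[OF \<open>0 \<le> y\<close>]
        by (intro exI[of _ "sinh y - y"]) (auto intro!: derivative_eq_intros)
    qed
    then show ?thesis by simp
  qed
  show ?thesis using *[of "\<bar>x\<bar>"] by simp
qed

text \<open>The derivative of \<open>x\<^sup>2 / 2 - ln (cosh x)\<close> is
  \<open>x - sinh x / cosh x\<close>, nonnegative for \<open>x \<ge> 0\<close>; evenness covers the
  rest.\<close>

lemma cosh_le_exp_square: "cosh x \<le> exp (x\<^sup>2 / 2)" for x :: real
proof -
  have g: "sinh y \<le> y * cosh y" if "y \<ge> 0" for y :: real
  proof -
    have "0 * cosh 0 - sinh 0 \<le> y * cosh y - sinh y"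
    proof (rule DERIV_nonneg_imp_nondecreasing[OF that])
      fix z :: real assume "0 \<le> z"
      show "\<exists>d. ((\<lambda>y. y * cosh y - sinh y) has_real_derivative d) (at z) \<and> 0 \<le> d"
        using \<open>0 \<le> z\<close>
        by (intro exI[of _ "z * sinh z"]) (auto intro!: derivative_eq_intros)
    qed
    then show ?thesis by simp
  qed
  have *: "cosh x \<le> exp (x\<^sup>2 / 2)" if "x \<ge> 0" for x :: real
  proof -
    have "0\<^sup>2 / 2 - ln (cosh 0) \<le> x\<^sup>2 / 2 - ln (cosh x)"
    proof (rule DERIV_nonneg_imp_nondecreasing[OF that])
      fix y :: real assume "0 \<le> y"
      show "\<exists>d. ((\<lambda>x. x\<^sup>2 / 2 - ln (cosh x)) has_real_derivative d) (at y) \<and> 0 \<le> d"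
        using g[OF \<open>0 \<le> y\<close>]
        by (intro exI[of _ "y - sinh y / cosh y"])
           (auto intro!: derivative_eq_intros simp: divide_simps cosh_real_pos)
    qed
    then have "ln (cosh x) \<le> x\<^sup>2 / 2" by simp
    then show ?thesis using cosh_real_pos[of x] by (metis exp_le_cancel_iff exp_ln)
  qed
  show ?thesis using *[of "\<bar>x\<bar>"] by simp
qed

text \<open>With \<open>t = x\<^sup>2 / 2\<close>, the quadratic bound gives \<open>1 + t\<close>,
  and \<open>ln (1 + t) \<ge> t - t\<^sup>2\<close> on [0, 1]; beyond 1 the exponent is not
  positive.\<close>

lemma cosh_ge_exp: "cosh x \<ge> exp (x\<^sup>2 / 2 * (1 - x\<^sup>2 / 2))" for x :: real
proof -
  define t where "t = x\<^sup>2 / 2"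
  have t: "t \<ge> 0" by (simp add: t_def)
  have "exp (t * (1 - t)) \<le> 1 + t"
  proof (cases "t \<le> 1")
    case True
    then have "t - t\<^sup>2 \<le> ln (1 + t)" using ln_one_plus_pos_lower_bound[of t] t by simp
    then have "exp (t - t\<^sup>2) \<le> exp (ln (1 + t))" by (simp only: exp_le_cancel_iff)
    then show ?thesis using t by (simp add: algebra_simps power2_eq_square)
  next
    case False
    then have "t * (1 - t) \<le> 0" using t by (intro mult_nonneg_nonpos) auto
    then have "exp (t * (1 - t)) \<le> 1" by simp
    then show ?thesis using t by linarith
  qed
  also have "\<dots> \<le> cosh x" using cosh_ge_quadratic[of x] by (simp add: t_def)
  finally show ?thesis by (simp add: t_def)
qed

section \<open>One step of the walk applied to a Gaussian\<close>

lemma gauss_step: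
  "exp (- \<beta> * (x + 1)\<^sup>2) + exp (- \<beta> * (x - 1)\<^sup>2) = 2 * exp (- \<beta>) * (exp (- \<beta> * x\<^sup>2) * cosh (2 * \<beta> * x))"
  for x \<beta> :: real
proof -
  have "exp (- \<beta> * (x + 1)\<^sup>2) = exp (- \<beta>) * exp (- \<beta> * x\<^sup>2) * exp (- (2 * \<beta> * x))"
    "exp (- \<beta> * (x - 1)\<^sup>2) = exp (- \<beta>) * exp (- \<beta> * x\<^sup>2) * exp (2 * \<beta> * x)"
    by (simp_all add: algebra_simps power2_eq_square flip: exp_add)
  then show ?thesis by (simp add: cosh_def algebra_simps)
qed

text \<open>The factor \<open>cosh (2 * \<beta> * x)\<close> is at most
  \<open>exp (2 * \<beta>\<^sup>2 * x\<^sup>2)\<close>, so averaging lowers the Gaussian exponent by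
  at most \<open>2 * \<beta>\<^sup>2\<close>.\<close>

lemma gauss_step_le:
  fixes x \<beta> b :: real
  assumes "b \<le> \<beta> - 2 * \<beta>\<^sup>2"
  shows "exp (- \<beta> * (x + 1)\<^sup>2) + exp (- \<beta> * (x - 1)\<^sup>2) \<le> 2 * exp (- \<beta>) * exp (- b * x\<^sup>2)"
proof -
  have "exp (- \<beta> * x\<^sup>2) * cosh (2 * \<beta> * x) \<le> exp (- \<beta> * x\<^sup>2) * exp ((2 * \<beta> * x)\<^sup>2 / 2)"
    by (intro mult_left_mono cosh_le_exp_square) auto
  also have "\<dots> = exp (- (\<beta> - 2 * \<beta>\<^sup>2) * x\<^sup>2)"
    by (simp add: algebra_simps power2_eq_square flip: exp_add)
  also have "\<dots> \<le> exp (- b * x\<^sup>2)"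
    using mult_right_mono[OF assms, of "x\<^sup>2"] by (simp add: algebra_simps)
  finally show ?thesis unfolding gauss_step by simp
qed

text \<open>The lower bound for cosh at \<open>2 * \<beta> * x\<close> brings in the factor
  \<open>1 - 2 * \<beta>\<^sup>2 * x\<^sup>2\<close>, close to 1 only for small
  \<open>\<beta> * x\<close>; hence a condition depending on \<open>x\<close>.\<close>

lemma gauss_step_ge:
  fixes x \<beta> b :: real
  assumes "\<beta> - b \<le> 2 * \<beta>\<^sup>2 * (1 - 2 * \<beta>\<^sup>2 * x\<^sup>2)"
  shows "exp (- \<beta> * (x + 1)\<^sup>2) + exp (- \<beta> * (x - 1)\<^sup>2) \<ge> 2 * exp (- \<beta>) * exp (- b * x\<^sup>2)"
proof -
  have "(\<beta> - b) * x\<^sup>2 \<le> 2 * \<beta>\<^sup>2 * (1 - 2 * \<beta>\<^sup>2 * x\<^sup>2) * x\<^sup>2"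
    using assms by (intro mult_right_mono) auto
  then have "exp (- b * x\<^sup>2) \<le> exp (- \<beta> * x\<^sup>2 + (2 * \<beta> * x)\<^sup>2 / 2 * (1 - (2 * \<beta> * x)\<^sup>2 / 2))"
    by (simp add: algebra_simps power_mult_distrib)
  also have "\<dots> = exp (- \<beta> * x\<^sup>2) * exp ((2 * \<beta> * x)\<^sup>2 / 2 * (1 - (2 * \<beta> * x)\<^sup>2 / 2))"
    by (rule exp_add)
  also have "\<dots> \<le> exp (- \<beta> * x\<^sup>2) * cosh (2 * \<beta> * x)"
    by (intro mult_left_mono cosh_ge_exp) auto
  finally show ?thesis unfolding gauss_step by simp
qed

text \<open>Up to the factor \<open>2 ^ k\<close>, the mean of a Gaussian of the endpoint under the
  killed walk; \<open>b = 0\<close> gives the total mass.\<close>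

definition gauss_count :: "real \<Rightarrow> nat \<Rightarrow> nat \<Rightarrow> real \<Rightarrow> real" where
  "gauss_count l m k b = (\<Sum>zs \<in> walks k. exp (- l * scaled_energy m zs) * exp (- b * (real_of_int (sum_list zs))\<^sup>2))"

lemma gauss_count_0 [simp]: "gauss_count l m 0 b = 1"
  by (simp add: gauss_count_def)

text \<open>The last energy weight is itself Gaussian in the new position, so it merges with the
  test function and raises \<open>b\<close>.\<close>

lemma gauss_count_Suc:
  "gauss_count l m (Suc k) b =
    (\<Sum>zs \<in> walks k. exp (- l * scaled_energy m zs) *
      (exp (- (b + l / real (m + Suc k)^2) * (real_of_int (sum_list zs) + 1)\<^sup>2) +
       exp (- (b + l / real (m + Suc k)^2) * (real_of_int (sum_list zs) - 1)\<^sup>2)))"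
  unfolding gauss_count_def sum_walks_Suc
proof (intro sum.cong refl)
  fix zs assume zs: "zs \<in> walks k"
  have *: "exp (- l * (Q + y\<^sup>2 / d)) * exp (- b * y\<^sup>2) = exp (- l * Q) * exp (- (b + l / d) * y\<^sup>2)"
    for Q y d :: real
    by (simp add: algebra_simps flip: exp_add)
  show "exp (- l * scaled_energy m (zs @ [1])) * exp (- b * (real_of_int (sum_list (zs @ [1])))\<^sup>2) +
        exp (- l * scaled_energy m (zs @ [-1])) * exp (- b * (real_of_int (sum_list (zs @ [-1])))\<^sup>2) =
        exp (- l * scaled_energy m zs) *
      (exp (- (b + l / real (m + Suc k)^2) * (real_of_int (sum_list zs) + 1)\<^sup>2) +
       exp (- (b + l / real (m + Suc k)^2) * (real_of_int (sum_list zs) - 1)\<^sup>2))"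
    using *[of "scaled_energy m zs" "real_of_int (sum_list zs + 1)" "real (m + Suc k)^2"]
      *[of "scaled_energy m zs" "real_of_int (sum_list zs - 1)" "real (m + Suc k)^2"]
    by (simp add: scaled_energy_snoc_walk[OF zs] distrib_left del: of_nat_Suc)
qed

text \<open>The last step is peeled off: merging with the energy and averaging replaces the exponent
  \<open>b j\<close> by at least \<open>b (j - 1)\<close>, with a factor
  \<open>2 * exp (- \<beta>)\<close>. At time \<open>m\<close> the walk is at 0, where the Gaussian
  is 1.\<close>

lemma gauss_count_le:
  assumes "\<And>j. m < j \<Longrightarrow> j \<le> m + k \<Longrightarrow>
    b (j - 1) \<le> (b j + l / real j ^ 2) - 2 * (b j + l / real j ^ 2)\<^sup>2"
  shows "gauss_count l m k (b (m + k)) \<le> 2 ^ k * exp (- (\<Sum>j = m + 1..m + k. b j + l / real j ^ 2))"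
  using assms
proof (induction k)
  case (Suc k)
  define \<beta> where "\<beta> = b (m + Suc k) + l / real (m + Suc k) ^ 2"
  have b: "b (m + k) \<le> \<beta> - 2 * \<beta>\<^sup>2"
    using Suc.prems[of "m + Suc k"] by (simp add: \<beta>_def)
  have "gauss_count l m (Suc k) (b (m + Suc k)) \<le>
      (\<Sum>zs \<in> walks k. exp (- l * scaled_energy m zs) * (2 * exp (- \<beta>) * exp (- b (m + k) * (real_of_int (sum_list zs))\<^sup>2)))"
    unfolding gauss_count_Suc \<beta>_def[symmetric] by (intro sum_mono mult_left_mono gauss_step_le b) auto
  also have "\<dots> = 2 * exp (- \<beta>) * gauss_count l m k (b (m + k))"
    by (simp add: gauss_count_def sum_distrib_left algebra_simps)
  also have "\<dots> \<le> 2 * exp (- \<beta>) * (2 ^ k * exp (- (\<Sum>j = m + 1..m + k. b j + l / real j ^ 2)))"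
    using Suc by (intro mult_left_mono) auto
  also have "\<dots> = 2 ^ Suc k * exp (- (\<Sum>j = m + 1..m + Suc k. b j + l / real j ^ 2))"
    by (simp add: \<beta>_def flip: exp_add)
  finally show ?case .
qed simp

lemma card_walks: "card (walks k) = 2 ^ k"
proof -
  have "real (card (walks k)) = 2 ^ k"
  proof (induction k)
    case (Suc k)
    have "real (card (walks (Suc k))) = (\<Sum>zs \<in> walks (Suc k). 1)" by simp
    also have "\<dots> = 2 ^ Suc k" unfolding sum_walks_Suc using Suc by simp
    finally show ?case .
  qed simp
  then show ?thesis by (metis of_nat_eq_iff of_nat_numeral of_nat_power)
qed

text \<open>The Gaussian is only required to be subharmonic where it exceeds \<open>\<theta>\<close>; in the application the
  exceptional points are those with \<open>\<bar>x\<bar> > \<delta> j\<close>, where \<open>exp (- b x\<^sup>2)\<close> is superpolynomially small.\<close>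

lemma gauss_count_ge:
  assumes "l \<ge> 0" and "\<And>j. m < j \<Longrightarrow> j \<le> m + k \<Longrightarrow> b j \<ge> 0"
    and "\<And>j x. m < j \<Longrightarrow> j \<le> m + k \<Longrightarrow> exp (- b (j - 1) * x\<^sup>2) \<le> \<theta> \<or>
    (b j + l / real j ^ 2) - b (j - 1) \<le>
      2 * (b j + l / real j ^ 2)\<^sup>2 * (1 - 2 * (b j + l / real j ^ 2)\<^sup>2 * x\<^sup>2)"
    and "\<theta> \<ge> 0"
  shows "gauss_count l m k (b (m + k)) \<ge> 2 ^ k * (exp (- (\<Sum>j = m + 1..m + k. b j + l / real j ^ 2)) - real k * \<theta>)"
  using assms(2,3)
proof (induction k)
  case (Suc k)
  define \<beta> where "\<beta> = b (m + Suc k) + l / real (m + Suc k) ^ 2"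
  have "\<beta> \<ge> 0" unfolding \<beta>_def
    using Suc.prems(1)[of "m + Suc k"] assms(1) by (intro add_nonneg_nonneg divide_nonneg_nonneg) auto
  then have \<beta>: "exp (- \<beta>) \<le> 1" by simp
  \<comment> \<open>Subtracting \<open>\<theta>\<close> makes the left side nonpositive at the
    exceptional points, so the inequality holds for every \<open>x\<close>.\<close>
  have step: "2 * exp (- \<beta>) * (exp (- b (m + k) * x\<^sup>2) - \<theta>) \<le> exp (- \<beta> * (x + 1)\<^sup>2) + exp (- \<beta> * (x - 1)\<^sup>2)" for x
  proof (cases "exp (- b (m + k) * x\<^sup>2) \<le> \<theta>")
    case True
    then have "2 * exp (- \<beta>) * (exp (- b (m + k) * x\<^sup>2) - \<theta>) \<le> 0"
      by (intro mult_nonneg_nonpos) auto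
    also have "\<dots> \<le> exp (- \<beta> * (x + 1)\<^sup>2) + exp (- \<beta> * (x - 1)\<^sup>2)" by simp
    finally show ?thesis .
  next
    case False
    then have "\<beta> - b (m + k) \<le> 2 * \<beta>\<^sup>2 * (1 - 2 * \<beta>\<^sup>2 * x\<^sup>2)"
      using Suc.prems(2)[of "m + Suc k" x] by (auto simp: \<beta>_def)
    note gauss_step_ge[OF this]
    moreover have "2 * exp (- \<beta>) * (exp (- b (m + k) * x\<^sup>2) - \<theta>) \<le> 2 * exp (- \<beta>) * exp (- b (m + k) * x\<^sup>2)"
      using assms(4) by (intro mult_left_mono) auto
    ultimately show ?thesis by linarith
  qed
  have q: "exp (- l * scaled_energy m zs) \<le> 1" for zs using assms(1) by (simp add: scaled_energy_nonneg)
  define P where "P = exp (- (\<Sum>j = m + 1..m + k. b j + l / real j ^ 2))"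
  \<comment> \<open>One more \<open>\<theta>\<close> per walk is lost in this step;
    \<open>exp (- \<beta>) \<le> 1\<close> lets the errors add up linearly.\<close>
  have "2 ^ Suc k * (exp (- \<beta>) * P - real (Suc k) * \<theta>) \<le> 2 * exp (- \<beta>) * (2 ^ k * (P - real k * \<theta>) - 2 ^ k * \<theta>)"
  proof -
    have "exp (- \<beta>) * (real (Suc k) * \<theta>) \<le> 1 * (real (Suc k) * \<theta>)"
      using \<beta> assms(4) by (intro mult_right_mono) auto
    then have "2 ^ Suc k * (exp (- \<beta>) * (real (Suc k) * \<theta>)) \<le> 2 ^ Suc k * (real (Suc k) * \<theta>)"
      by (intro mult_left_mono) auto
    then show ?thesis by (simp add: algebra_simps)
  qed
  also have "\<dots> \<le> 2 * exp (- \<beta>) * (gauss_count l m k (b (m + k)) - 2 ^ k * \<theta>)"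
    using Suc unfolding P_def by (intro mult_left_mono diff_right_mono) auto
  also have "\<dots> = 2 * exp (- \<beta>) * (gauss_count l m k (b (m + k)) - (\<Sum>zs \<in> walks k. \<theta>))"
    by (simp add: card_walks)
  also have "\<dots> \<le> 2 * exp (- \<beta>) * (gauss_count l m k (b (m + k)) - (\<Sum>zs \<in> walks k. exp (- l * scaled_energy m zs) * \<theta>))"
    using mult_right_mono[OF q assms(4)] by (intro mult_left_mono diff_left_mono sum_mono) auto
  also have "\<dots> = (\<Sum>zs \<in> walks k. exp (- l * scaled_energy m zs) * (2 * exp (- \<beta>) * (exp (- b (m + k) * (real_of_int (sum_list zs))\<^sup>2) - \<theta>)))"
    by (simp add: gauss_count_def sum_distrib_left sum_subtractf algebra_simps)
  also have "\<dots> \<le> gauss_count l m (Suc k) (b (m + Suc k))"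
    unfolding gauss_count_Suc \<beta>_def[symmetric] by (intro sum_mono mult_left_mono step) auto
  finally show ?case
    by (simp add: \<beta>_def P_def flip: exp_add)
qed simp

text \<open>Within distance \<open>R\<close> there are \<open>2 * R + 1\<close> endpoints, none
  heavier than 0 by unimodality; outside, the Gaussian is at most its value at \<open>R\<close> and
  there are at most \<open>2 ^ k\<close> walks.\<close>

lemma gauss_count_le_centre:
  assumes "l \<ge> 0" "even k" "b \<ge> 0"
  shows "gauss_count l m k b \<le> (2 * real R + 1) * tilted_count l m k 0 + 2 ^ k * exp (- b * (real R)\<^sup>2)"
proof -
  have le: "exp (- l * scaled_energy m zs) * exp (- b * (real_of_int (sum_list zs))\<^sup>2) \<le>
    (\<Sum>x \<in> {- int R..int R}. exp (- l * scaled_energy m zs) * of_bool (sum_list zs = x)) + exp (- b * (real R)\<^sup>2)" for zs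
  proof (cases "\<bar>sum_list zs\<bar> \<le> int R")
    case True
    then have "(\<Sum>x \<in> {- int R..int R}. exp (- l * scaled_energy m zs) * of_bool (sum_list zs = x)) = exp (- l * scaled_energy m zs)"
      by (simp add: sum_distrib_left[symmetric] of_bool_def abs_le_iff)
    moreover have "exp (- l * scaled_energy m zs) * exp (- b * (real_of_int (sum_list zs))\<^sup>2) \<le> exp (- l * scaled_energy m zs) * 1"
      using assms by (intro mult_left_mono) auto
    ultimately show ?thesis by (simp add: add_increasing2)
  next
    case False
    then have "\<bar>real R\<bar> \<le> \<bar>real_of_int (sum_list zs)\<bar>" by linarith
    then have "(real R)\<^sup>2 \<le> (real_of_int (sum_list zs))\<^sup>2" by (simp only: abs_le_square_iff)
    then have "exp (- b * (real_of_int (sum_list zs))\<^sup>2) \<le> exp (- b * (real R)\<^sup>2)"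
      using assms by (simp add: mult_left_mono)
    moreover have "exp (- l * scaled_energy m zs) \<le> 1" using assms by (simp add: scaled_energy_nonneg)
    ultimately have "exp (- l * scaled_energy m zs) * exp (- b * (real_of_int (sum_list zs))\<^sup>2) \<le> 1 * exp (- b * (real R)\<^sup>2)"
      by (intro mult_mono) auto
    moreover have "(\<Sum>x \<in> {- int R..int R}. exp (- l * scaled_energy m zs) * of_bool (sum_list zs = x)) \<ge> 0"
      by (intro sum_nonneg) auto
    ultimately show ?thesis by linarith
  qed
  have "gauss_count l m k b \<le> (\<Sum>zs \<in> walks k. (\<Sum>x \<in> {- int R..int R}. exp (- l * scaled_energy m zs) * of_bool (sum_list zs = x)) + exp (- b * (real R)\<^sup>2))"
    unfolding gauss_count_def by (intro sum_mono le)
  also have "\<dots> = (\<Sum>x \<in> {- int R..int R}. tilted_count l m k x) + 2 ^ k * exp (- b * (real R)\<^sup>2)"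
    unfolding sum.distrib tilted_count_def by (subst sum.swap) (simp add: card_walks)
  also have "(\<Sum>x \<in> {- int R..int R}. tilted_count l m k x) \<le> (\<Sum>x \<in> {- int R..int R}. tilted_count l m k 0)"
    by (intro sum_mono tilted_count_le_centre assms)
  also have "\<dots> = (2 * real R + 1) * tilted_count l m k 0"
    by simp
  finally show ?thesis by simp
qed

subsection \<open>Bounds for fixed length\<close>

definition return_prob :: "nat \<Rightarrow> real" where
  "return_prob q = real ((2 * q) choose q) / 4 ^ q"

lemma return_prob_Suc: "return_prob (Suc q) = return_prob q * (2 * real q + 1) / (2 * real q + 2)"
proof -
  have *: "return_prob q = fact (2 * q) / (fact q * fact q) / 4 ^ q" for q
    using binomial_fact[of q "2 * q", where 'a = real] by (simp add: return_prob_def)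
  have "fact (2 * Suc q) = (2 * real q + 2) * (2 * real q + 1) * (fact (2 * q) :: real)"
    by (simp add: algebra_simps)
  then show ?thesis
    unfolding * by (simp add: divide_simps del: mult_Suc_right) (simp add: algebra_simps)
qed

lemma return_prob_pos: "return_prob q > 0"
  by (simp add: return_prob_def)

text \<open>By the ratio recursion, \<open>(return_prob q)\<^sup>2 * (2 * real q + 1)\<close> is
  nonincreasing, with value 1 at \<open>q = 0\<close>.\<close>

lemma return_prob_upper: "return_prob q \<le> 1 / sqrt (2 * real q + 1)"
proof -
  have "(return_prob q)\<^sup>2 * (2 * real q + 1) \<le> 1"
  proof (induction q)
    case (Suc q)
    have "(2 * real q + 1) * (2 * real q + 3) \<le> (2 * real q + 2)\<^sup>2"
      by (simp add: power2_eq_square algebra_simps)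
    then have r: "(2 * real q + 1) * (2 * real q + 3) / (2 * real q + 2)\<^sup>2 \<le> 1" by simp
    have "(return_prob (Suc q))\<^sup>2 * (2 * real (Suc q) + 1) =
        (return_prob q)\<^sup>2 * (2 * real q + 1) * ((2 * real q + 1) * (2 * real q + 3) / (2 * real q + 2)\<^sup>2)"
      unfolding return_prob_Suc by (simp add: power2_eq_square)
    also have "\<dots> \<le> 1 * 1" using Suc r by (intro mult_mono) auto
    finally show ?case by simp
  qed (simp add: return_prob_def)
  then have "(return_prob q)\<^sup>2 \<le> 1 / (2 * real q + 1)" by (simp add: pos_le_divide_eq)
  then have "return_prob q \<le> sqrt (1 / (2 * real q + 1))" by (rule real_le_rsqrt)
  then show ?thesis by (simp add: real_sqrt_divide)
qed

text \<open>By the same recursion, \<open>(return_prob q)\<^sup>2 * real q\<close> is nondecreasing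
  from its value 1/4 at \<open>q = 1\<close>.\<close>

lemma return_prob_lower: "q \<ge> 1 \<Longrightarrow> return_prob q \<ge> 1 / (2 * sqrt (real q))"
proof -
  assume q: "q \<ge> 1"
  have "1 / 4 \<le> (return_prob q)\<^sup>2 * real q"
    using q
  proof (induction q rule: nat_induct_at_least)
    case base
    show ?case by (simp add: return_prob_def power2_eq_square)
  next
    case (Suc q)
    have r: "1 \<le> (2 * real q + 1)\<^sup>2 * (real q + 1) / ((2 * real q + 2)\<^sup>2 * real q)"
    proof -
      have "(2 * real q + 2)\<^sup>2 * real q \<le> (2 * real q + 1)\<^sup>2 * (real q + 1)"
        by (simp add: power2_eq_square algebra_simps)
      moreover have "(2 * real q + 2)\<^sup>2 * real q > 0" using Suc(1) by simp
      ultimately show ?thesis by (simp only: le_divide_eq_1_pos)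
    qed
    have "1 / 4 * 1 \<le> (return_prob q)\<^sup>2 * real q * ((2 * real q + 1)\<^sup>2 * (real q + 1) / ((2 * real q + 2)\<^sup>2 * real q))"
      using Suc r by (intro mult_mono) auto
    also have "\<dots> = (return_prob (Suc q))\<^sup>2 * real (Suc q)"
      unfolding return_prob_Suc using Suc(1) by (simp add: power_mult_distrib power_divide add.commute)
    finally show ?case by simp
  qed
  then have "1 / (4 * real q) \<le> (return_prob q)\<^sup>2" using q by (simp add: field_simps)
  then have "sqrt (1 / (4 * real q)) \<le> return_prob q"
    using return_prob_pos[of q] by (intro real_le_lsqrt) auto
  then show ?thesis by (simp add: real_sqrt_divide real_sqrt_mult)
qed

section \<open>Harmonic sums and sums of inverse squares\<close>

lemma harmonic_ge: "ln (real (m + k) + 1) - ln (real m + 1) \<le> (\<Sum>j = m + 1..m + k. 1 / real j)"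
proof (induction k)
  case (Suc k)
  have "ln (1 + 1 / real (m + Suc k)) \<le> 1 / real (m + Suc k)"
    by (intro ln_add_one_self_le_self) auto
  moreover have "1 + 1 / real (m + Suc k) = (real (m + Suc k) + 1) / (real (m + k) + 1)"
    by (simp add: field_simps)
  moreover have "ln ((real (m + Suc k) + 1) / (real (m + k) + 1)) = ln (real (m + Suc k) + 1) - ln (real (m + k) + 1)"
    by (subst ln_div) auto
  ultimately have "ln (real (m + Suc k) + 1) - ln (real (m + k) + 1) \<le> 1 / real (m + Suc k)"
    by (simp only:)
  with Suc show ?case by simp
qed simp

lemma harmonic_le:
  assumes "m \<ge> 1"
  shows "(\<Sum>j = m + 1..m + k. 1 / real j) \<le> ln (real (m + k)) - ln (real m)"
proof (induction k)
  case (Suc k)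
  have "ln (real (m + k) / real (m + Suc k)) \<le> real (m + k) / real (m + Suc k) - 1"
    using assms by (intro ln_le_minus_one) auto
  also have "\<dots> = - 1 / real (m + Suc k)" by (simp add: field_simps)
  finally have "1 / real (m + Suc k) \<le> ln (real (m + Suc k)) - ln (real (m + k))"
    using assms by (simp add: ln_div)
  with Suc show ?case by simp
qed simp

lemma sum_inverse_squares_le:
  assumes "m \<ge> 1"
  shows "(\<Sum>j = m + 1..m + k. 1 / real j ^ 2) \<le> 1 / real m - 1 / real (m + k)"
proof (induction k)
  case (Suc k)
  have "1 / real (m + Suc k) ^ 2 \<le> 1 / (real (m + k) * real (m + Suc k))"
    using assms by (intro divide_left_mono) (auto simp: power2_eq_square intro!: mult_right_mono)
  also have "\<dots> = 1 / real (m + k) - 1 / real (m + Suc k)"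
    using assms by (simp add: field_simps)
  finally show ?case using Suc by simp
qed simp

text \<open>The last \<open>2 * q\<close> steps run free and give \<open>return_prob q\<close>; the
  first \<open>k\<close> are controlled by a superharmonic Gaussian. The hypothesis
  \<open>cond\<close> is superharmonicity multiplied by the square of \<open>j\<close>; for large
  \<open>j\<close> it tends to \<open>l \<ge> a * (a + 1) / 2\<close>.\<close>

lemma tilted_count_upper:
  assumes "l \<ge> 0" "a \<ge> 0" "m \<ge> 1"
    and cond: "\<And>j. j > m \<Longrightarrow> l - (a + 2 * l / real j)\<^sup>2 / 2 - a / 2 * (real j / (real j - 1)) \<ge> 0"
  shows "tilted_count l m (k + 2 * q) 0 \<le>
    2 ^ k * 4 ^ q * exp (a / 2 * (1 + ln (real m + 1) - ln (real (m + k) + 1))) * return_prob q"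
proof -
  text \<open>Subtracting \<open>1 / M\<close> makes \<open>b\<close> vanish at the final time \<open>m + k\<close>, so no factor is lost there, at the
    price of a constant.\<close>
  define M where "M = real (m + k)"
  define b where "b = (\<lambda>j::nat. a / 2 * (1 / real j - 1 / M))"
  have M: "M \<ge> 1" using assms by (simp add: M_def)
  have "tilted_count l m (k + 2 * q) 0 \<le> (\<Sum>ys \<in> walks k. exp (- l * scaled_energy m ys) * tilted_count 0 0 (2 * q) (0 - sum_list ys))"
    by (rule tilted_count_add_le) fact
  also have "\<dots> \<le> (\<Sum>ys \<in> walks k. exp (- l * scaled_energy m ys) * tilted_count 0 0 (2 * q) 0)"
    by (intro sum_mono mult_left_mono tilted_count_le_centre) auto
  also have "\<dots> = gauss_count l m k (b (m + k)) * (4 ^ q * return_prob q)"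
    by (simp add: gauss_count_def b_def M_def tilted_count_central return_prob_def sum_distrib_right)
  also have "gauss_count l m k (b (m + k)) \<le> 2 ^ k * exp (- (\<Sum>j = m + 1..m + k. b j + l / real j ^ 2))"
  proof (rule gauss_count_le)
    fix j assume j: "m < j" "j \<le> m + k"
    have j2: "real j \<ge> 2" using j assms by simp
    define \<beta> where "\<beta> = b j + l / real j ^ 2"
    define g where "g = a + 2 * l / real j"
    have "1 / M \<le> 1 / real j" using j assms by (simp add: M_def frac_le)
    then have "b j \<ge> 0" using assms by (simp add: b_def)
    then have \<beta>0: "\<beta> \<ge> 0" using assms by (simp add: \<beta>_def)
    have "b j \<le> a / 2 * (1 / real j)" unfolding b_def using M assms by (intro mult_left_mono) auto
    then have "\<beta> \<le> a / 2 * (1 / real j) + l / real j ^ 2" by (simp add: \<beta>_def)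
    also have "\<dots> = g / (2 * real j)" using j2 by (simp add: g_def field_simps power2_eq_square)
    finally have "\<beta>\<^sup>2 \<le> (g / (2 * real j))\<^sup>2" using \<beta>0 by (intro power_mono)
    then have "2 * \<beta>\<^sup>2 \<le> (g\<^sup>2 / 2) / real j ^ 2" by (simp add: power_divide power_mult_distrib)
    also have "\<dots> \<le> (l - a / 2 * (real j / (real j - 1))) / real j ^ 2"
      using cond[OF j(1)] by (intro divide_right_mono) (auto simp: g_def)
    also have "\<dots> = l / real j ^ 2 - a / 2 * (1 / (real j - 1) - 1 / real j)"
    proof -
      have "(real j / (real j - 1)) / real j ^ 2 = 1 / (real j - 1) - 1 / real j"
        using j2 by (simp add: divide_simps power2_eq_square)
      then show ?thesis by (metis diff_divide_distrib times_divide_eq_right)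
    qed
    also have "\<dots> = l / real j ^ 2 + b j - b (j - 1)"
      using j by (simp add: b_def of_nat_diff algebra_simps)
    finally show "b (j - 1) \<le> b j + l / real j ^ 2 - 2 * (b j + l / real j ^ 2)\<^sup>2"
      by (simp add: \<beta>_def)
  qed
  also have "exp (- (\<Sum>j = m + 1..m + k. b j + l / real j ^ 2)) \<le>
      exp (a / 2 * (1 + ln (real m + 1) - ln (real (m + k) + 1)))"
  proof -
    \<comment> \<open>The subtracted \<open>1 / M\<close> sums to \<open>real k / M\<close>, at most
      1: this is the \<open>1\<close> in the exponent.\<close>
    have "a / 2 * (ln (real (m + k) + 1) - ln (real m + 1) - 1) \<le> a / 2 * ((\<Sum>j = m + 1..m + k. 1 / real j) - real k / M)"
      using harmonic_ge[of m k] M assms(2) by (intro mult_left_mono diff_mono) (auto simp: M_def)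
    also have "\<dots> = (\<Sum>j = m + 1..m + k. b j)"
      unfolding b_def sum_distrib_left[symmetric] sum_subtractf by simp
    also have "\<dots> \<le> (\<Sum>j = m + 1..m + k. b j + l / real j ^ 2)"
      using assms(1) by (intro sum_mono) auto
    finally show ?thesis by (simp add: algebra_simps)
  qed
  finally show ?thesis using return_prob_pos[of q] by (simp add: mult_ac)
qed

text \<open>Here \<open>cond\<close> is subharmonicity of the Gaussian with exponent
  \<open>a / (2 * real j)\<close>, multiplied by the square of \<open>j\<close>, at distances up to
  \<open>\<delta> * (j - 1)\<close>. The two subtracted terms are the error from larger distances
  and the Gaussian tail beyond \<open>R\<close>.\<close>

lemma tilted_count_lower:
  assumes "l \<ge> 0" "a \<ge> 0" "m \<ge> 1" "even k"
    and cond: "\<And>j. j > m \<Longrightarrow> (a + 2 * l / real j)\<^sup>2 / 2 * (1 - \<delta>\<^sup>2 / 2 * (a + 2 * l / real j)\<^sup>2) - (l - a / 2) \<ge> 0"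
  shows "2 ^ k * (exp (- a / 2 * ln (real (m + k)) - l) - real k * exp (- a * \<delta>\<^sup>2 / 2 * real m)
      - exp (- a * (real R)\<^sup>2 / (2 * real (m + k)))) \<le> (2 * real R + 1) * tilted_count l m k 0"
proof -
  define b where "b = (\<lambda>j::nat. a / (2 * real j))"
  define \<theta> where "\<theta> = exp (- a * \<delta>\<^sup>2 / 2 * real m)"
  have "exp (- a / 2 * ln (real (m + k)) - l) \<le> exp (- (\<Sum>j = m + 1..m + k. b j + l / real j ^ 2))"
  proof -
    have "(\<Sum>j = m + 1..m + k. b j + l / real j ^ 2) =
        a / 2 * (\<Sum>j = m + 1..m + k. 1 / real j) + l * (\<Sum>j = m + 1..m + k. 1 / real j ^ 2)"
      by (simp add: b_def sum.distrib sum_distrib_left)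
    also have "\<dots> \<le> a / 2 * ln (real (m + k)) + l * 1"
    proof (intro add_mono mult_left_mono)
      have "ln (real m) \<ge> 0" using assms(3) by simp
      then show "(\<Sum>j = m + 1..m + k. 1 / real j) \<le> ln (real (m + k))"
        using harmonic_le[OF assms(3), of k] by linarith
      have "1 / real m \<le> 1" "1 / real (m + k) \<ge> 0" using assms(3) by auto
      then show "(\<Sum>j = m + 1..m + k. 1 / real j ^ 2) \<le> 1"
        using sum_inverse_squares_le[OF assms(3), of k] by linarith
    qed (use assms in auto)
    finally show ?thesis by simp
  qed
  then have "2 ^ k * (exp (- a / 2 * ln (real (m + k)) - l) - real k * \<theta>) \<le>
      2 ^ k * (exp (- (\<Sum>j = m + 1..m + k. b j + l / real j ^ 2)) - real k * \<theta>)"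
    by simp
  also have "\<dots> \<le> gauss_count l m k (b (m + k))"
  proof (rule gauss_count_ge)
    fix j x assume j: "m < j" "j \<le> m + k"
    have j2: "real j \<ge> 2" using j assms by simp
    have j1: "real (j - 1) = real j - 1" using j by simp
    show "exp (- b (j - 1) * x\<^sup>2) \<le> \<theta> \<or>
      b j + l / real j ^ 2 - b (j - 1) \<le> 2 * (b j + l / real j ^ 2)\<^sup>2 * (1 - 2 * (b j + l / real j ^ 2)\<^sup>2 * x\<^sup>2)"
    proof (cases "x\<^sup>2 \<le> \<delta>\<^sup>2 * (real j - 1)\<^sup>2")
      case False
      \<comment> \<open>Far from the origin the Gaussian is below \<open>\<theta>\<close>, because
        \<open>j - 1\<close> is at least \<open>m\<close>.\<close>
      have "a * \<delta>\<^sup>2 / 2 * real m \<le> a * \<delta>\<^sup>2 / 2 * (real j - 1)"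
        using j assms by (intro mult_left_mono) auto
      also have "\<dots> = a / (2 * (real j - 1)) * (\<delta>\<^sup>2 * (real j - 1)\<^sup>2)"
        using j2 by (simp add: field_simps power2_eq_square)
      also have "\<dots> \<le> b (j - 1) * x\<^sup>2"
        unfolding b_def j1 using False j2 assms by (intro mult_left_mono) auto
      finally show ?thesis by (simp add: \<theta>_def)
    next
      case True
      define g where "g = a + 2 * l / real j"
      have \<beta>: "b j + l / real j ^ 2 = g / (2 * real j)"
        using j2 by (simp add: b_def g_def field_simps power2_eq_square)
      have "x\<^sup>2 \<le> \<delta>\<^sup>2 * real j ^ 2"
        using True by (rule order_trans) (use j2 in \<open>auto intro!: mult_left_mono power_mono\<close>)
      then have x: "x\<^sup>2 / real j ^ 2 \<le> \<delta>\<^sup>2" using j2 by (simp add: divide_le_eq)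
      have "a / (2 * real j) / real j \<le> a / (2 * real j) / (real j - 1)"
        using j2 assms by (intro divide_left_mono) auto
      also have "\<dots> = b (j - 1) - b j" using j2 by (simp add: b_def j1 field_simps)
      finally have "b j + l / real j ^ 2 - b (j - 1) \<le> (l - a / 2) / real j ^ 2"
        by (simp add: diff_divide_distrib power2_eq_square)
      also have "\<dots> \<le> (g\<^sup>2 / 2 * (1 - \<delta>\<^sup>2 / 2 * g\<^sup>2)) / real j ^ 2"
        using cond[OF j(1)] by (intro divide_right_mono) (auto simp: g_def)
      also have "\<dots> = g\<^sup>2 / (2 * real j ^ 2) * (1 - g\<^sup>2 / 2 * \<delta>\<^sup>2)"
        by (simp add: mult.commute)
      also have "\<dots> \<le> g\<^sup>2 / (2 * real j ^ 2) * (1 - g\<^sup>2 / 2 * (x\<^sup>2 / real j ^ 2))"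
        using x by (intro mult_left_mono diff_left_mono) auto
      also have "\<dots> = 2 * (g / (2 * real j))\<^sup>2 * (1 - 2 * (g / (2 * real j))\<^sup>2 * x\<^sup>2)"
        by (simp add: power_divide power_mult_distrib)
      finally show ?thesis unfolding \<beta> by blast
    qed
  qed (use assms in \<open>auto simp: b_def \<theta>_def\<close>)
  also have "\<dots> \<le> (2 * real R + 1) * tilted_count l m k 0 + 2 ^ k * exp (- b (m + k) * (real R)\<^sup>2)"
    using assms by (intro gauss_count_le_centre) (auto simp: b_def)
  finally show ?thesis by (simp add: b_def \<theta>_def algebra_simps)
qed

subsection \<open>Asymptotics of the Laplace transform\<close>

text \<open>The power 9 generously absorbs the floor and the shift. What matters is that the
  starting time grows faster than \<open>ln (real n)\<close> while its logarithm is negligible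
  against \<open>ln (real n)\<close>.\<close>

lemma Apar_bounds:
  "\<forall>\<^sub>F n in sequentially. 2 \<le> Apar n \<and> 2 * Apar n \<le> n \<and>
     ln (real n) ^ 9 \<le> real (2 * Apar n - 2) \<and> real (2 * Apar n - 2) \<le> 2 * ln (real n) ^ 10"
proof -
  have "\<forall>\<^sub>F n :: nat in sequentially. ln (real n) ^ 10 \<ge> 2"
    "\<forall>\<^sub>F n :: nat in sequentially. 2 * ln (real n) ^ 10 \<le> real n"
    "\<forall>\<^sub>F n :: nat in sequentially. ln (real n) ^ 9 \<le> 2 * ln (real n) ^ 10 - 4"
    by real_asymp+
  then show ?thesis
  proof eventually_elim
    case (elim n)
    define L where "L = ln (real n) ^ 10"
    have A: "real (Apar n) = of_int \<lfloor>L\<rfloor>" using elim by (simp add: Apar_def L_def)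
    have "2 \<le> \<lfloor>L\<rfloor>" using elim by (simp add: L_def le_floor_iff)
    then have A2: "2 \<le> Apar n" unfolding Apar_def L_def by linarith
    have le: "real (Apar n) \<le> L" "real (Apar n) \<ge> L - 1" unfolding A by linarith+
    have "real (2 * Apar n) \<le> real n" using le elim by (simp add: L_def)
    then have "2 * Apar n \<le> n" by (simp only: of_nat_le_iff)
    moreover have "real (2 * Apar n - 2) = 2 * real (Apar n) - 2" using A2 by (simp add: of_nat_diff)
    ultimately show ?case using A2 le elim by (simp add: L_def)
  qed
qed

text \<open>The starting time tends to infinity, so limits in \<open>j\<close> supply the hypotheses
  \<open>cond\<close> of the fixed-length bounds.\<close>

lemma eventually_gt_Apar:
  assumes "\<forall>\<^sub>F j in sequentially. Q j"
  shows "\<forall>\<^sub>F n in sequentially. \<forall>j > 2 * Apar n - 2. Q j"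
proof -
  obtain J where J: "\<And>j. j \<ge> J \<Longrightarrow> Q j" using assms by (auto simp: eventually_sequentially)
  have "\<forall>\<^sub>F n :: nat in sequentially. real J \<le> ln (real n) ^ 9" by real_asymp
  then show ?thesis using Apar_bounds
  proof eventually_elim
    case (elim n)
    then have "real J \<le> real (2 * Apar n - 2)" by linarith
    then have "J \<le> 2 * Apar n - 2" by (simp only: of_nat_le_iff)
    then show ?case using J by auto
  qed
qed

text \<open>The Laplace transform of the energy under the uniform law on bridges, written with
  endpoint weights so that the bounds above apply.\<close>

definition bridge_mgf :: "real \<Rightarrow> nat \<Rightarrow> real" where
  "bridge_mgf l n = tilted_count l (2 * Apar n - 2) (2 * (n - Apar n)) 0 / tilted_count 0 0 (2 * (n - Apar n)) 0"

text \<open>For \<open>a'\<close> slightly below \<open>a\<close> the superharmonicity condition is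
  strict in the limit. About half of the steps run free, so the return probabilities cancel up to a
  factor 2, while the Gaussian part still runs up to a time of order \<open>n\<close>.\<close>

lemma bridge_mgf_upper:
  assumes "a > 0" "\<delta> > 0"
  shows "\<forall>\<^sub>F n in sequentially. bridge_mgf (a * (a + 1) / 2) n \<le> exp ((- a / 2 + \<delta>) * ln (real n))"
proof -
  define l where "l = a * (a + 1) / 2"
  \<comment> \<open>The minimum loses at most \<open>\<delta>\<close> and keeps \<open>a'\<close>
    positive.\<close>
  define a' where "a' = a - min \<delta> (a / 2)"
  have a': "a' > 0" "a' < a" "a' \<ge> a - \<delta>" using assms by (auto simp: a'_def)
  have l: "l \<ge> 0" using assms by (simp add: l_def)
  have "a' * (a' + 1) < a * (a + 1)" using a' by (intro mult_strict_mono) auto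
  then have pos: "0 < l - a'\<^sup>2 / 2 - a' / 2" by (simp add: l_def power2_eq_square field_simps)
  have lim: "(\<lambda>j. 2 * l / real j) \<longlonglongrightarrow> 0" "(\<lambda>j. real j / (real j - 1)) \<longlonglongrightarrow> 1"
    by real_asymp+
  have "((\<lambda>j::nat. l - (a' + 2 * l / real j)\<^sup>2 / 2 - a' / 2 * (real j / (real j - 1))) \<longlongrightarrow> l - (a' + 0)\<^sup>2 / 2 - a' / 2 * 1) sequentially"
    by (intro tendsto_intros lim) auto
  from order_tendstoD(1)[OF this, of 0]
  have "\<forall>\<^sub>F j in sequentially. l - (a' + 2 * l / real j)\<^sup>2 / 2 - a' / 2 * (real j / (real j - 1)) > 0"
    using pos by simp
  note cond = eventually_gt_Apar[OF this]
  have "((\<lambda>n::nat. (a' / 2 * (1 + ln (2 * ln (real n) ^ 10 + 1) - ln (real n / 2)) + ln 2) / ln (real n)) \<longlongrightarrow> - a' / 2) sequentially"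
    by real_asymp
  from order_tendstoD(2)[OF this, of "- a / 2 + \<delta>"]
  have "\<forall>\<^sub>F n::nat in sequentially. (a' / 2 * (1 + ln (2 * ln (real n) ^ 10 + 1) - ln (real n / 2)) + ln 2) / ln (real n) < - a / 2 + \<delta>"
    using a' assms by (simp add: field_simps)
  with cond Apar_bounds eventually_ge_at_top[of 10]
  have "\<forall>\<^sub>F n in sequentially. bridge_mgf l n \<le> exp ((- a / 2 + \<delta>) * ln (real n))"
  proof eventually_elim
    case (elim n)
    define m where "m = 2 * Apar n - 2"
    define q where "q = n div 2"
    define p where "p = n - Apar n"
    define k where "k = 2 * p - 2 * q"
    have A: "2 \<le> Apar n" "2 * Apar n \<le> n" using elim by auto
    have qp: "q \<le> p" using A by (simp add: q_def p_def)
    then have kq: "k + 2 * q = 2 * p" by (simp add: k_def)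
    have "2 ^ k * 4 ^ q = (2 :: real) ^ (k + 2 * q)" by (simp add: power_add power_mult)
    also have "\<dots> = 4 ^ p" unfolding kq by (simp add: power_mult)
    finally have k2: "2 ^ k * 4 ^ q = (4 :: real) ^ p" .
    have "m + k \<ge> n - 2" using A qp by (simp add: m_def k_def p_def q_def)
    then have M: "real (m + k) + 1 \<ge> real n / 2" using elim(4) by linarith
    have "tilted_count l m (k + 2 * q) 0 \<le>
        2 ^ k * 4 ^ q * exp (a' / 2 * (1 + ln (real m + 1) - ln (real (m + k) + 1))) * return_prob q"
      using l a' A elim(1) by (intro tilted_count_upper) (auto simp: m_def intro: less_imp_le)
    then have "tilted_count l m (2 * p) 0 \<le> 4 ^ p * (exp (a' / 2 * (1 + ln (real m + 1) - ln (real (m + k) + 1))) * return_prob q)"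
      unfolding kq k2 by (simp add: mult_ac)
    then have "bridge_mgf l n \<le> exp (a' / 2 * (1 + ln (real m + 1) - ln (real (m + k) + 1))) * return_prob q / return_prob p"
      unfolding bridge_mgf_def m_def[symmetric] p_def[symmetric] tilted_count_central
      by (simp add: return_prob_def field_simps)
    also have "\<dots> \<le> exp (a' / 2 * (1 + ln (2 * ln (real n) ^ 10 + 1) - ln (real n / 2))) * 2"
    proof -
      \<comment> \<open>The number \<open>2 * q\<close> of free steps is at least
        \<open>p - 1\<close>, so both return probabilities have the same order.\<close>
      have "return_prob q \<le> 2 * return_prob p"
      proof -
        have "p \<ge> 1" using A by (simp add: p_def)
        have "p \<le> 2 * q + 1" by (simp add: p_def q_def)
        then have "real p \<le> real (2 * q + 1)" by (simp only: of_nat_le_iff)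
        then have "sqrt (real p) \<le> sqrt (2 * real q + 1)" by (simp add: real_sqrt_le_mono)
        then have "1 / sqrt (2 * real q + 1) \<le> 1 / sqrt (real p)"
          using \<open>p \<ge> 1\<close> by (intro divide_left_mono) auto
        with return_prob_upper[of q] return_prob_lower[OF \<open>p \<ge> 1\<close>] show ?thesis by simp
      qed
      then have "return_prob q / return_prob p \<le> 2" using return_prob_pos[of p] by (simp add: divide_le_eq)
      moreover have "a' / 2 * (1 + ln (real m + 1) - ln (real (m + k) + 1)) \<le> a' / 2 * (1 + ln (2 * ln (real n) ^ 10 + 1) - ln (real n / 2))"
        using a' elim M by (intro mult_left_mono diff_mono add_left_mono ln_mono) (auto simp: m_def)
      ultimately have "exp (a' / 2 * (1 + ln (real m + 1) - ln (real (m + k) + 1))) * (return_prob q / return_prob p)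
          \<le> exp (a' / 2 * (1 + ln (2 * ln (real n) ^ 10 + 1) - ln (real n / 2))) * 2"
        using return_prob_pos[of p] return_prob_pos[of q] by (intro mult_mono) auto
      then show ?thesis by simp
    qed
    also have "\<dots> = exp (a' / 2 * (1 + ln (2 * ln (real n) ^ 10 + 1) - ln (real n / 2)) + ln 2)"
      by (subst exp_add) simp
    also have "\<dots> \<le> exp ((- a / 2 + \<delta>) * ln (real n))"
      using elim by (simp add: divide_less_eq)
    finally show ?case .
  qed
  then show ?thesis by (simp add: l_def)
qed

text \<open>For \<open>a'\<close> above \<open>a\<close> the Gaussian is strictly subharmonic near
  the origin. The \<open>2 * R + 1\<close> endpoints cost the square root of \<open>n\<close> up to
  logarithms, which dividing by \<open>return_prob p\<close> restores.\<close>

lemma bridge_mgf_lower: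
  assumes "a > 0" "\<delta> > 0"
  shows "\<forall>\<^sub>F n in sequentially. exp ((- a / 2 - \<delta>) * ln (real n)) \<le> bridge_mgf (a * (a + 1) / 2) n"
proof -
  define l where "l = a * (a + 1) / 2"
  define a' where "a' = a + \<delta>"
  have a': "a' > 0" "a < a'" using assms by (auto simp: a'_def)
  have l: "l \<ge> 0" using assms by (simp add: l_def)
  have "a * (a + 1) < a' * (a' + 1)" using a' assms by (intro mult_strict_mono) auto
  then have pos: "0 < a'\<^sup>2 / 2 * (1 - 0\<^sup>2 / 2 * a'\<^sup>2) - (l - a' / 2)"
    by (simp add: l_def power2_eq_square field_simps)
  \<comment> \<open>The condition is strict at \<open>e = 0\<close>, so by continuity some positive
    \<open>e\<close> works; it serves as \<open>\<delta>\<close> in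
    \<open>tilted_count_lower\<close>.\<close>
  have "((\<lambda>e. a'\<^sup>2 / 2 * (1 - e\<^sup>2 / 2 * a'\<^sup>2) - (l - a' / 2)) \<longlongrightarrow> a'\<^sup>2 / 2 * (1 - 0\<^sup>2 / 2 * a'\<^sup>2) - (l - a' / 2)) (at_right 0)"
    by (intro tendsto_intros) auto
  from order_tendstoD(1)[OF this pos] eventually_at_right_less[of 0]
  have "\<forall>\<^sub>F e in at_right 0. a'\<^sup>2 / 2 * (1 - e\<^sup>2 / 2 * a'\<^sup>2) - (l - a' / 2) > 0 \<and> e > 0"
    by eventually_elim auto
  then obtain e where e: "a'\<^sup>2 / 2 * (1 - e\<^sup>2 / 2 * a'\<^sup>2) - (l - a' / 2) > 0" "e > 0"
    by (auto dest!: eventually_happens)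
  have lim: "(\<lambda>j. 2 * l / real j) \<longlonglongrightarrow> 0"
    by real_asymp
  have "((\<lambda>j::nat. (a' + 2 * l / real j)\<^sup>2 / 2 * (1 - e\<^sup>2 / 2 * (a' + 2 * l / real j)\<^sup>2) - (l - a' / 2)) \<longlongrightarrow>
      (a' + 0)\<^sup>2 / 2 * (1 - e\<^sup>2 / 2 * (a' + 0)\<^sup>2) - (l - a' / 2)) sequentially"
    by (intro tendsto_intros lim) auto
  from order_tendstoD(1)[OF this, of 0]
  have "\<forall>\<^sub>F j in sequentially. (a' + 2 * l / real j)\<^sup>2 / 2 * (1 - e\<^sup>2 / 2 * (a' + 2 * l / real j)\<^sup>2) - (l - a' / 2) > 0"
    using e by simp
  note cond = eventually_gt_Apar[OF this]
  define B where "B = a' * e\<^sup>2 / 2"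
  have B: "B > 0" using a' e by (simp add: B_def)
  \<comment> \<open>Both errors are superpolynomially small, whereas the main term decays only
    polynomially.\<close>
  have err: "\<forall>\<^sub>F n::nat in sequentially. 2 * real n * exp (- B * ln (real n) ^ 9) + exp (- a' / 2 * ln (real n) ^ 2)
      \<le> exp (- a' / 2 * ln (2 * real n) - l) / 2"
    using B a' by real_asymp
  have "((\<lambda>n::nat. (- a' / 2 * ln (2 * real n) - l - ln 2 + ln (sqrt (real n) / (2 * (sqrt (2 * real n) * ln (real n) + 1) + 1))) / ln (real n)) \<longlongrightarrow> - a' / 2) sequentially"
    by real_asymp
  from order_tendstoD(1)[OF this, of "- a / 2 - \<delta>"]
  have "\<forall>\<^sub>F n::nat in sequentially. (- a' / 2 * ln (2 * real n) - l - ln 2 + ln (sqrt (real n) / (2 * (sqrt (2 * real n) * ln (real n) + 1) + 1))) / ln (real n) > - a / 2 - \<delta>"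
    using assms by (simp add: a'_def)
  with err cond Apar_bounds eventually_ge_at_top[of 10]
  have "\<forall>\<^sub>F n in sequentially. exp ((- a / 2 - \<delta>) * ln (real n)) \<le> bridge_mgf l n"
  proof eventually_elim
    case (elim n)
    define m where "m = 2 * Apar n - 2"
    define p where "p = n - Apar n"
    \<comment> \<open>The extra logarithm pushes the Gaussian tail at \<open>R\<close> below every
      power of \<open>n\<close>, yet costs nothing at the exponential scale.\<close>
    define R where "R = nat \<lceil>sqrt (2 * real n) * ln (real n)\<rceil>"
    define W where "W = 2 * (sqrt (2 * real n) * ln (real n) + 1) + 1"
    define P where "P = exp (- a' / 2 * ln (2 * real n) - l)"
    have A: "2 \<le> Apar n" "2 * Apar n \<le> n" using elim by auto
    have mp: "m + 2 * p \<le> 2 * n" "m \<ge> 1" "2 * p \<le> 2 * n" "real n \<le> 2 * real p + 1" "p \<ge> 1"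
      using A by (auto simp: m_def p_def)
    have ln0: "ln (real n) > 0" using elim by simp
    have R: "real R \<ge> sqrt (2 * real n) * ln (real n)" "real R \<le> sqrt (2 * real n) * ln (real n) + 1"
      using ln0 unfolding R_def by (auto simp: of_nat_ceiling) 
    have W: "2 * real R + 1 \<le> W" using R by (simp add: W_def)
    have "2 ^ (2 * p) * (exp (- a' / 2 * ln (real (m + 2 * p)) - l) - real (2 * p) * exp (- a' * e\<^sup>2 / 2 * real m)
      - exp (- a' * (real R)\<^sup>2 / (2 * real (m + 2 * p)))) \<le> (2 * real R + 1) * tilted_count l m (2 * p) 0"
      using l a' mp elim by (intro tilted_count_lower) (auto simp: m_def intro: less_imp_le)
    moreover have "P / 2 \<le> exp (- a' / 2 * ln (real (m + 2 * p)) - l) - real (2 * p) * exp (- a' * e\<^sup>2 / 2 * real m)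
      - exp (- a' * (real R)\<^sup>2 / (2 * real (m + 2 * p)))"
    proof -
      have "ln (real (m + 2 * p)) \<le> ln (2 * real n)" using mp by (intro ln_mono) auto
      then have 1: "P \<le> exp (- a' / 2 * ln (real (m + 2 * p)) - l)"
        using a' by (simp add: P_def)
      have "exp (- a' * e\<^sup>2 / 2 * real m) \<le> exp (- B * ln (real n) ^ 9)"
      proof -
        have "B * ln (real n) ^ 9 \<le> B * real m"
          using elim B unfolding m_def by (intro mult_left_mono) auto
        then show ?thesis by (simp add: B_def)
      qed
      then have 2: "real (2 * p) * exp (- a' * e\<^sup>2 / 2 * real m) \<le> 2 * real n * exp (- B * ln (real n) ^ 9)"
        using mp by (intro mult_mono) auto
      have "(sqrt (2 * real n) * ln (real n))\<^sup>2 \<le> (real R)\<^sup>2" using R ln0 by (intro power_mono) auto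
      then have "2 * real n * ln (real n) ^ 2 \<le> (real R)\<^sup>2" by (simp add: power_mult_distrib)
      moreover have "real (m + 2 * p) * ln (real n) ^ 2 \<le> 2 * real n * ln (real n) ^ 2"
        using mp by (intro mult_right_mono) auto
      ultimately have "ln (real n) ^ 2 \<le> (real R)\<^sup>2 / real (m + 2 * p)"
      proof -
        assume "2 * real n * ln (real n) ^ 2 \<le> (real R)\<^sup>2" "real (m + 2 * p) * ln (real n) ^ 2 \<le> 2 * real n * ln (real n) ^ 2"
        then have "ln (real n) ^ 2 * real (m + 2 * p) \<le> (real R)\<^sup>2" by (simp only: mult.commute)
        moreover have "real (m + 2 * p) > 0" using mp by simp
        ultimately show ?thesis by (simp only: pos_le_divide_eq)
      qed
      then have "a' / 2 * ln (real n) ^ 2 \<le> a' / 2 * ((real R)\<^sup>2 / real (m + 2 * p))"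
        using a' by (intro mult_left_mono) auto
      then have 3: "exp (- a' * (real R)\<^sup>2 / (2 * real (m + 2 * p))) \<le> exp (- a' / 2 * ln (real n) ^ 2)"
        by simp
      show ?thesis using 1 2 3 elim(1) unfolding P_def by linarith
    qed
    ultimately have "2 ^ (2 * p) * (P / 2) \<le> (2 * real R + 1) * tilted_count l m (2 * p) 0"
      by (meson mult_left_mono order_trans zero_le_numeral zero_le_power)
    also have "\<dots> \<le> W * tilted_count l m (2 * p) 0"
      using W by (intro mult_right_mono tilted_count_nonneg)
    finally have Z: "4 ^ p * (P / 2) \<le> W * tilted_count l m (2 * p) 0" by (simp add: power_mult)
    have W0: "W > 0" using W by linarith
    have "exp ((- a / 2 - \<delta>) * ln (real n)) \<le> exp (- a' / 2 * ln (2 * real n) - l - ln 2 + ln (sqrt (real n) / W))"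
      using elim(5) ln0 by (simp add: W_def less_divide_eq)
    also have "\<dots> = P / 2 * (sqrt (real n) / W)"
      using W0 elim(4) by (simp add: P_def exp_add exp_diff)
    also have "\<dots> \<le> P / 2 / W * (1 / return_prob p)"
    proof -
      have "sqrt (real n) \<le> sqrt (2 * real p + 1)" using mp by (intro real_sqrt_le_mono) auto
      also have "\<dots> \<le> 1 / return_prob p"
        using return_prob_upper[of p] return_prob_pos[of p] by (simp add: field_simps)
      finally have "P / 2 / W * sqrt (real n) \<le> P / 2 / W * (1 / return_prob p)"
        using W0 by (intro mult_left_mono) (auto simp: P_def)
      then show ?thesis by simp
    qed
    also have "\<dots> \<le> tilted_count l m (2 * p) 0 / 4 ^ p * (1 / return_prob p)"
    proof (rule mult_right_mono)
      show "P / 2 / W \<le> tilted_count l m (2 * p) 0 / 4 ^ p"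
        using Z W0 by (simp add: field_simps)
    qed (use return_prob_pos[of p] in simp)
    also have "\<dots> = bridge_mgf l n"
      unfolding bridge_mgf_def m_def[symmetric] p_def[symmetric] tilted_count_central by (simp add: return_prob_def)
    finally show ?case .
  qed
  then show ?thesis by (simp add: l_def)
qed

subsection \<open>From the Laplace transform to probabilities\<close>

text \<open>The upper bound is Chernoff's inequality. For the lower bound, a pointwise minorant of
  the indicator made of three exponentials replaces the change of measure, so only Laplace
  transforms at \<open>a\<close>, \<open>a - h\<close> and \<open>a + h\<close> enter.\<close>

lemma finite_gaertner_ellis:
  fixes \<Omega> :: "nat \<Rightarrow> 'a set" and X :: "nat \<Rightarrow> 'a \<Rightarrow> real" and c :: real
  assumes c: "0 < c" "c < 1"
    and fin: "\<And>n. finite (\<Omega> n)"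
    and mgf_le: "\<And>a \<delta>. a > 0 \<Longrightarrow> \<delta> > 0 \<Longrightarrow> \<forall>\<^sub>F n in sequentially.
      (\<Sum>\<omega> \<in> \<Omega> n. exp (- (a * (a + 1) / 2) * X n \<omega>)) / card (\<Omega> n) \<le> exp ((- a / 2 + \<delta>) * ln n)"
    and mgf_ge: "\<And>a \<delta>. a > 0 \<Longrightarrow> \<delta> > 0 \<Longrightarrow> \<forall>\<^sub>F n in sequentially.
      exp ((- a / 2 - \<delta>) * ln n) \<le> (\<Sum>\<omega> \<in> \<Omega> n. exp (- (a * (a + 1) / 2) * X n \<omega>)) / card (\<Omega> n)"
    and \<delta>: "\<delta> > 0"
  defines "P \<equiv> \<lambda>n. real (card {\<omega> \<in> \<Omega> n. X n \<omega> \<le> c * ln (real n)}) / real (card (\<Omega> n))"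
  shows "\<forall>\<^sub>F n in sequentially. P n \<le> exp ((- Kfun c + \<delta>) * ln (real n))"
    and "\<forall>\<^sub>F n in sequentially. exp ((- Kfun c - \<delta>) * ln (real n)) \<le> P n"
proof -
  define lam where "lam = (\<lambda>a::real. a * (a + 1) / 2)"
  define R where "R = (\<lambda>a n. (\<Sum>\<omega> \<in> \<Omega> n. exp (- lam a * X n \<omega>)) / card (\<Omega> n))"
  have R_le: "\<forall>\<^sub>F n in sequentially. R a n \<le> exp ((- a / 2 + \<delta>) * ln n)" if "a > 0" "\<delta> > 0" for a \<delta>
    unfolding R_def lam_def using mgf_le[OF that] .
  have R_ge: "\<forall>\<^sub>F n in sequentially. exp ((- a / 2 - \<delta>) * ln n) \<le> R a n" if "a > 0" "\<delta> > 0" for a \<delta>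
    unfolding R_def lam_def using mgf_ge[OF that] .
  have P: "P n = (\<Sum>\<omega> \<in> \<Omega> n. of_bool (X n \<omega> \<le> c * ln n)) / card (\<Omega> n)" for n
    unfolding P_def using fin[of n] by (simp add: of_bool_def sum.If_cases Int_def)
  \<comment> \<open>The stationary point of \<open>lam a * c - a / 2\<close>, that is, the solution
    of \<open>c * (2 * a + 1) = 1\<close>.\<close>
  define a\<^sub>0 where "a\<^sub>0 = (1 - c) / (2 * c)"
  have a0: "a\<^sub>0 > 0" using c by (simp add: a\<^sub>0_def)
  have K: "lam a\<^sub>0 * c - a\<^sub>0 / 2 = - Kfun c"
    using c by (simp add: lam_def Kfun_def a\<^sub>0_def divide_simps power2_eq_square) (simp add: algebra_simps)
  have lam_nonneg: "lam a \<ge> 0" if "a \<ge> 0" for a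
    using that by (simp add: lam_def)

  show "\<forall>\<^sub>F n in sequentially. P n \<le> exp ((- Kfun c + \<delta>) * ln (real n))"
    using R_le[OF a0 \<delta>]
  proof eventually_elim
    case (elim n)
    have "of_bool (X n \<omega> \<le> c * ln n) \<le> exp (lam a\<^sub>0 * c * ln n) * exp (- lam a\<^sub>0 * X n \<omega>)" for \<omega>
    proof (cases "X n \<omega> \<le> c * ln n")
      case True
      then have "0 \<le> lam a\<^sub>0 * (c * ln n - X n \<omega>)" using lam_nonneg[of a\<^sub>0] a0 by simp
      then have "1 \<le> exp (lam a\<^sub>0 * (c * ln n - X n \<omega>))" by simp
      then show ?thesis using True by (simp add: algebra_simps flip: exp_add)
    qed simp
    then have "P n \<le> (\<Sum>\<omega> \<in> \<Omega> n. exp (lam a\<^sub>0 * c * ln n) * exp (- lam a\<^sub>0 * X n \<omega>)) / card (\<Omega> n)"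
      unfolding P by (intro divide_right_mono sum_mono) auto
    also have "\<dots> = exp (lam a\<^sub>0 * c * ln n) * R a\<^sub>0 n"
      by (simp add: R_def sum_distrib_left)
    also have "\<dots> \<le> exp (lam a\<^sub>0 * c * ln n) * exp ((- a\<^sub>0 / 2 + \<delta>) * ln n)"
      using elim by simp
    also have "\<dots> = exp ((lam a\<^sub>0 * c - a\<^sub>0 / 2 + \<delta>) * ln n)"
      by (simp add: algebra_simps flip: exp_add)
    finally show ?case unfolding K .
  qed

  text \<open>The tilting parameter \<open>a\<close> is taken slightly above the optimal value, so that the
    tilted law concentrates at \<open>1 / (2 * a + 1)\<close>, strictly between \<open>c\<^sub>1\<close> and \<open>c\<close>.\<close>
  have lim: "((\<lambda>t. lam (a\<^sub>0 + t) * (1 / (2 * (a\<^sub>0 + t) + 1) - t) - (a\<^sub>0 + t) / 2) \<longlongrightarrow> - Kfun c) (at_right 0)"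
  proof -
    have "1 / (2 * a\<^sub>0 + 1) = c" using c by (simp add: a\<^sub>0_def field_simps)
    moreover have "((\<lambda>t. lam (a\<^sub>0 + t) * (1 / (2 * (a\<^sub>0 + t) + 1) - t) - (a\<^sub>0 + t) / 2) \<longlongrightarrow>
        lam (a\<^sub>0 + 0) * (1 / (2 * (a\<^sub>0 + 0) + 1) - 0) - (a\<^sub>0 + 0) / 2) (at_right 0)"
      unfolding lam_def using a0 by (intro tendsto_intros) auto
    ultimately show ?thesis using K by simp
  qed
  have "\<forall>\<^sub>F t in at_right 0. lam (a\<^sub>0 + t) * (1 / (2 * (a\<^sub>0 + t) + 1) - t) - (a\<^sub>0 + t) / 2 > - Kfun c - \<delta> / 2"
    using \<delta> by (intro order_tendstoD(1)[OF lim]) auto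
  moreover have "\<forall>\<^sub>F t in at_right 0. (0::real) < t" by (simp add: eventually_at_right_less)
  ultimately have "\<forall>\<^sub>F t in at_right 0. lam (a\<^sub>0 + t) * (1 / (2 * (a\<^sub>0 + t) + 1) - t) - (a\<^sub>0 + t) / 2 > - Kfun c - \<delta> / 2 \<and> 0 < t"
    by eventually_elim auto
  then obtain t where t: "lam (a\<^sub>0 + t) * (1 / (2 * (a\<^sub>0 + t) + 1) - t) - (a\<^sub>0 + t) / 2 > - Kfun c - \<delta> / 2" "t > 0"
    by (auto dest!: eventually_happens)
  define a where "a = a\<^sub>0 + t"
  define c\<^sub>1 where "c\<^sub>1 = 1 / (2 * a + 1) - t"
  have a: "a > 0" using a0 t by (simp add: a_def)
  have main: "lam a * c\<^sub>1 - a / 2 > - Kfun c - \<delta> / 2" using t by (simp add: a_def c\<^sub>1_def)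
  have c1: "c\<^sub>1 * (2 * a + 1) < 1"
    using t a by (simp add: c\<^sub>1_def algebra_simps add_pos_pos)
  have c2: "c * (2 * a + 1) > 1"
    using t c by (simp add: a_def a\<^sub>0_def field_simps)
  \<comment> \<open>Positivity of \<open>s * c - h / 2\<close> and
    \<open>h / 2 - s' * c\<^sub>1\<close>, which makes the two corrections negligible, is checked
    after division by \<open>h\<close>, in the limit of small \<open>h\<close>.\<close>
  have lim1: "((\<lambda>h. (a + 1 / 2 - h / 2) * c) \<longlongrightarrow> (a + 1 / 2 - 0 / 2) * c) (at_right 0)"
    by (intro tendsto_intros) auto
  have lim2: "((\<lambda>h. (a + 1 / 2 + h / 2) * c\<^sub>1) \<longlongrightarrow> (a + 1 / 2 + 0 / 2) * c\<^sub>1) (at_right 0)"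
    by (intro tendsto_intros) auto
  have "\<forall>\<^sub>F h in at_right 0. (a + 1 / 2 - h / 2) * c > 1 / 2"
    using c2 by (intro order_tendstoD(1)[OF lim1]) (simp add: algebra_simps)
  moreover have "\<forall>\<^sub>F h in at_right 0. (a + 1 / 2 + h / 2) * c\<^sub>1 < 1 / 2"
    using c1 by (intro order_tendstoD(2)[OF lim2]) (simp add: algebra_simps)
  moreover have "\<forall>\<^sub>F h in at_right 0. h \<in> {0<..<a}"
    using a by (intro eventually_at_right_real)
  ultimately have "\<forall>\<^sub>F h in at_right 0. (a + 1 / 2 - h / 2) * c > 1 / 2 \<and> (a + 1 / 2 + h / 2) * c\<^sub>1 < 1 / 2 \<and> h \<in> {0<..<a}"
    by eventually_elim auto
  then obtain h where h: "(a + 1 / 2 - h / 2) * c > 1 / 2" "(a + 1 / 2 + h / 2) * c\<^sub>1 < 1 / 2" "0 < h" "h < a"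
    by (auto dest!: eventually_happens)
  define s where "s = h * (a + 1 / 2 - h / 2)"
  define s' where "s' = h * (a + 1 / 2 + h / 2)"
  have s: "lam (a - h) = lam a - s" "lam (a + h) = lam a + s'"
    by (auto simp: lam_def s_def s'_def field_simps)
  have s_pos: "s > 0" "s' > 0"
    unfolding s_def s'_def using h a by (auto intro!: mult_pos_pos)
  have gap: "s * c - h / 2 > 0" "h / 2 - s' * c\<^sub>1 > 0"
    using mult_strict_left_mono[OF h(1) h(3)] mult_strict_left_mono[OF h(2) h(3)]
    by (auto simp: s_def s'_def mult.assoc)
  \<comment> \<open>With \<open>\<delta> / 4\<close>, a loss of \<open>2 * \<eta>\<close> fits into
    the \<open>\<delta> / 2\<close> left over by \<open>main\<close>; the gaps keep each correction
    a factor \<open>exp (- \<eta> * T)\<close> below the main term.\<close>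
  define \<eta> where "\<eta> = min (\<delta> / 4) (min (s * c - h / 2) (h / 2 - s' * c\<^sub>1) / 4)"
  have \<eta>: "\<eta> > 0" "\<eta> \<le> \<delta> / 4" "4 * \<eta> \<le> s * c - h / 2" "4 * \<eta> \<le> h / 2 - s' * c\<^sub>1"
    using gap \<delta> by (auto simp: \<eta>_def min_def)
  \<comment> \<open>Each of the two corrections is then at most a quarter of the lower bound for the
    main term, leaving half of it.\<close>
  have big: "\<forall>\<^sub>F n in sequentially. exp (- \<eta> * ln (real n)) \<le> 1 / 4"
  proof -
    have "filterlim (\<lambda>n. \<eta> * ln (real n)) at_top sequentially"
      using \<eta> by (intro filterlim_tendsto_pos_mult_at_top[OF tendsto_const]
          filterlim_compose[OF ln_at_top filterlim_real_sequentially])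
    then have "\<forall>\<^sub>F n in sequentially. \<eta> * ln (real n) \<ge> ln 4" by (simp add: filterlim_at_top)
    then show ?thesis
    proof eventually_elim
      case (elim n)
      then have "exp (- \<eta> * ln (real n)) \<le> exp (- ln 4)" by simp
      also have "\<dots> = 1 / 4" by (subst exp_minus) simp
      finally show ?case .
    qed
  qed
  have h': "a - h > 0" "a + h > 0" using h a by auto
  show "\<forall>\<^sub>F n in sequentially. exp ((- Kfun c - \<delta>) * ln (real n)) \<le> P n"
    using R_ge[OF a \<eta>(1)] R_le[OF h'(1) \<eta>(1)] R_le[OF h'(2) \<eta>(1)] big eventually_ge_at_top[of 1]
  proof eventually_elim
    case (elim n)
    define T where "T = ln (real n)"
    have T: "T \<ge> 0" using elim by (simp add: T_def)
    \<comment> \<open>Above \<open>c * T\<close> the term tilted to \<open>a - h\<close> dominates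
      the main one, below \<open>c\<^sub>1 * T\<close> the term tilted to \<open>a + h\<close> does.
      In between, the prefactor bounds the main term by 1.\<close>
    have point: "exp (lam a * c\<^sub>1 * T) * (exp (- lam a * X n \<omega>)
        - exp (- s * c * T) * exp (- lam (a - h) * X n \<omega>)
        - exp (s' * c\<^sub>1 * T) * exp (- lam (a + h) * X n \<omega>)) \<le> of_bool (X n \<omega> \<le> c * T)" (is "?E * (?u - ?v - ?w) \<le> _") for \<omega>
    proof -
      have v: "?v = exp (- lam a * X n \<omega> + s * (X n \<omega> - c * T))"
        by (simp add: s algebra_simps flip: exp_add)
      have w: "?w = exp (- lam a * X n \<omega> + s' * (c\<^sub>1 * T - X n \<omega>))"
        by (simp add: s algebra_simps flip: exp_add)
      consider "X n \<omega> > c * T" | "X n \<omega> < c\<^sub>1 * T" | "c\<^sub>1 * T \<le> X n \<omega>" "X n \<omega> \<le> c * T" by linarith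
      then show ?thesis
      proof cases
        case 1
        then have "?u \<le> ?v" unfolding v using s_pos by simp
        moreover have "?w \<ge> 0" by simp
        ultimately have "?u - ?v - ?w \<le> 0" by linarith
        then have "?E * (?u - ?v - ?w) \<le> 0" by (intro mult_nonneg_nonpos) auto
        then show ?thesis using 1 by simp
      next
        case 2
        then have "?u \<le> ?w" unfolding w using s_pos by simp
        moreover have "?v \<ge> 0" by simp
        ultimately have "?u - ?v - ?w \<le> 0" by linarith
        then have "?E * (?u - ?v - ?w) \<le> 0" by (intro mult_nonneg_nonpos) auto
        then show ?thesis by (rule order_trans) simp
      next
        case 3
        have "?v \<ge> 0" "?w \<ge> 0" by simp_all
        then have "?u - ?v - ?w \<le> ?u" by linarith
        then have "?E * (?u - ?v - ?w) \<le> ?E * ?u" by (intro mult_left_mono) auto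
        also have "\<dots> = exp (lam a * (c\<^sub>1 * T - X n \<omega>))" by (simp add: algebra_simps flip: exp_add)
        also have "\<dots> \<le> 1" using 3 lam_nonneg[of a] a by (simp add: mult_nonneg_nonpos)
        finally show ?thesis using 3 by simp
      qed
    qed
    have e1: "exp (- s * c * T) * R (a - h) n \<le> exp ((- a / 2 - \<eta>) * T) * exp (- \<eta> * T)"
    proof -
      have "exp (- s * c * T) * R (a - h) n \<le> exp (- s * c * T) * exp ((- (a - h) / 2 + \<eta>) * T)"
        using elim h by (simp add: T_def)
      also have "\<dots> = exp ((- s * c - (a - h) / 2 + \<eta>) * T)" by (subst exp_add[symmetric]) (simp add: field_simps)
      also have "\<dots> \<le> exp ((- a / 2 - \<eta> - \<eta>) * T)"
      proof -
        have "- s * c - (a - h) / 2 + \<eta> \<le> - a / 2 - \<eta> - \<eta>" using \<eta> by (simp add: field_simps)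
        from mult_right_mono[OF this T] show ?thesis by simp
      qed
      also have "\<dots> = exp ((- a / 2 - \<eta>) * T) * exp (- \<eta> * T)" by (subst exp_add[symmetric]) (simp add: field_simps)
      finally show ?thesis .
    qed
    have e2: "exp (s' * c\<^sub>1 * T) * R (a + h) n \<le> exp ((- a / 2 - \<eta>) * T) * exp (- \<eta> * T)"
    proof -
      have "exp (s' * c\<^sub>1 * T) * R (a + h) n \<le> exp (s' * c\<^sub>1 * T) * exp ((- (a + h) / 2 + \<eta>) * T)"
        using elim h by (simp add: T_def)
      also have "\<dots> = exp ((s' * c\<^sub>1 - (a + h) / 2 + \<eta>) * T)" by (subst exp_add[symmetric]) (simp add: field_simps)
      also have "\<dots> \<le> exp ((- a / 2 - \<eta> - \<eta>) * T)"
      proof -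
        have "s' * c\<^sub>1 - (a + h) / 2 + \<eta> \<le> - a / 2 - \<eta> - \<eta>" using \<eta> by (simp add: field_simps)
        from mult_right_mono[OF this T] show ?thesis by simp
      qed
      also have "\<dots> = exp ((- a / 2 - \<eta>) * T) * exp (- \<eta> * T)" by (subst exp_add[symmetric]) (simp add: field_simps)
      finally show ?thesis .
    qed
    have q: "exp (- \<eta> * T) \<le> 1 / 4" using elim by (simp add: T_def)
    have "exp ((- a / 2 - \<eta>) * T) * exp (- \<eta> * T) \<le> exp ((- a / 2 - \<eta>) * T) * (1 / 4)"
      using q by (intro mult_left_mono) auto
    then have "exp ((- a / 2 - \<eta>) * T) * (1 / 2) \<le> R a n - exp (- s * c * T) * R (a - h) n - exp (s' * c\<^sub>1 * T) * R (a + h) n"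
      using e1 e2 elim(1) unfolding T_def[symmetric] by linarith
    moreover have "exp ((- a / 2 - \<eta>) * T) * exp (- \<eta> * T) \<le> exp ((- a / 2 - \<eta>) * T) * (1 / 2)"
      using q by (intro mult_left_mono) auto
    moreover have "exp ((- a / 2 - 2 * \<eta>) * T) = exp ((- a / 2 - \<eta>) * T) * exp (- \<eta> * T)"
      by (subst exp_add[symmetric]) (simp add: algebra_simps)
    ultimately have low: "exp ((- a / 2 - 2 * \<eta>) * T) \<le> R a n - exp (- s * c * T) * R (a - h) n - exp (s' * c\<^sub>1 * T) * R (a + h) n"
      by linarith
    have "exp ((- Kfun c - \<delta>) * T) \<le> exp ((lam a * c\<^sub>1 - a / 2 - 2 * \<eta>) * T)"
      using main \<eta> T by (auto intro!: mult_right_mono)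
    also have "\<dots> = exp (lam a * c\<^sub>1 * T) * exp ((- a / 2 - 2 * \<eta>) * T)"
      by (simp add: algebra_simps flip: exp_add)
    also have "\<dots> \<le> exp (lam a * c\<^sub>1 * T) * (R a n - exp (- s * c * T) * R (a - h) n - exp (s' * c\<^sub>1 * T) * R (a + h) n)"
      using low by (intro mult_left_mono) auto
    also have "\<dots> = (\<Sum>\<omega> \<in> \<Omega> n. exp (lam a * c\<^sub>1 * T) * (exp (- lam a * X n \<omega>)
        - exp (- s * c * T) * exp (- lam (a - h) * X n \<omega>)
        - exp (s' * c\<^sub>1 * T) * exp (- lam (a + h) * X n \<omega>))) / card (\<Omega> n)"
      unfolding R_def sum_distrib_left[symmetric] sum_subtractf
      by (simp add: diff_divide_distrib right_diff_distrib)
    also have "\<dots> \<le> P n"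
      unfolding P T_def[symmetric] by (intro divide_right_mono sum_mono point) auto
    finally show ?case by (simp add: T_def)
  qed
qed

lemma bridge_mgf_eq_mean:
  "bridge_mgf l n =
    (\<Sum>zs \<in> {zs \<in> walks (2 * (n - Apar n)). sum_list zs = 0}. exp (- l * scaled_energy (2 * Apar n - 2) zs)) /
      real (card {zs \<in> walks (2 * (n - Apar n)). sum_list zs = 0})"
proof -
  have "tilted_count l m k 0 = (\<Sum>zs \<in> {zs \<in> walks k. sum_list zs = 0}. exp (- l * scaled_energy m zs))" for m k
    by (simp add: tilted_count_def of_bool_def if_distrib[of "(*) _"] sum.If_cases Int_def cong: if_cong)
  then show ?thesis by (simp add: bridge_mgf_def tilted_count_central card_bridges)
qed

theorem theoremt4:
  fixes c :: real
  assumes "0 < c" and "c < 1"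
  shows "\<exists>\<epsilon> :: nat \<Rightarrow> real. \<epsilon> \<longlonglongrightarrow> 0 \<and>
           (\<forall>\<^sub>F n in sequentially. condprob c n = exp (- (Kfun c + \<epsilon> n) * ln (real n)))"
proof -
  define \<Omega> where "\<Omega> = (\<lambda>n. {zs \<in> walks (2 * (n - Apar n)). sum_list zs = 0})"
  define P where "P = (\<lambda>n. real (card {zs \<in> \<Omega> n. scaled_energy (2 * Apar n - 2) zs \<le> c * ln (real n)}) / real (card (\<Omega> n)))"
  have fin: "finite (\<Omega> n)" for n by (simp add: \<Omega>_def)
  have mean: "bridge_mgf l n = (\<Sum>zs \<in> \<Omega> n. exp (- l * scaled_energy (2 * Apar n - 2) zs)) / real (card (\<Omega> n))" for l n
    unfolding \<Omega>_def by (rule bridge_mgf_eq_mean)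
  note mgf = bridge_mgf_upper[unfolded mean] bridge_mgf_lower[unfolded mean]
  have bounds: "\<forall>\<^sub>F n in sequentially. P n \<le> exp ((- Kfun c + \<delta>) * ln (real n))"
    "\<forall>\<^sub>F n in sequentially. exp ((- Kfun c - \<delta>) * ln (real n)) \<le> P n" if "\<delta> > 0" for \<delta>
    unfolding P_def
    using finite_gaertner_ellis[where \<Omega> = \<Omega> and X = "\<lambda>n. scaled_energy (2 * Apar n - 2)", OF assms fin mgf that]
    by blast+
  have condprob: "\<forall>\<^sub>F n in sequentially. condprob c n = P n"
    using Apar_bounds
    by eventually_elim (simp add: condprob_bridges P_def \<Omega>_def)
  \<comment> \<open>Solving the claimed identity for the error makes it exact wherever
    \<open>P n > 0\<close> and \<open>ln (real n) > 0\<close>; only convergence needs the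
    bounds.\<close>
  define \<epsilon> where "\<epsilon> = (\<lambda>n. - ln (P n) / ln (real n) - Kfun c)"
  have "\<epsilon> \<longlonglongrightarrow> 0"
  proof (rule tendstoI)
    fix e :: real assume "e > 0"
    then have "e / 2 > 0" by simp
    from bounds[OF this] eventually_ge_at_top[of 2]
    show "\<forall>\<^sub>F n in sequentially. dist (\<epsilon> n) 0 < e"
    proof eventually_elim
      case (elim n)
      have ln0: "ln (real n) > 0" using elim(3) by simp
      have "P n > 0" using elim(2) exp_gt_zero less_le_trans by blast
      then have "ln (P n) \<le> (- Kfun c + e / 2) * ln (real n)" "(- Kfun c - e / 2) * ln (real n) \<le> ln (P n)"
        using elim(1,2) ln_le_cancel_iff[of "P n" "exp _"] by (auto simp: ln_ge_iff)
      then have "ln (P n) / ln (real n) \<le> - Kfun c + e / 2" "- Kfun c - e / 2 \<le> ln (P n) / ln (real n)"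
        using ln0 by (simp_all add: divide_le_eq le_divide_eq)
      then show ?case using \<open>e > 0\<close> by (simp add: \<epsilon>_def dist_real_def abs_less_iff)
    qed
  qed
  moreover have "\<forall>\<^sub>F n in sequentially. condprob c n = exp (- (Kfun c + \<epsilon> n) * ln (real n))"
    \<comment> \<open>The lower bound with \<open>\<delta> = 1\<close> serves only to make
      \<open>P n\<close> positive.\<close>
    using condprob bounds(2)[OF zero_less_one] eventually_ge_at_top[of 2]
  proof eventually_elim
    case (elim n)
    have "P n > 0" using elim(2) exp_gt_zero less_le_trans by blast
    then show ?case using elim(1,3) by (simp add: \<epsilon>_def)
  qed
  ultimately show ?thesis by blast
qed

end
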